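(* In the unique winner model, computing whether a coalition of manipulators can manipulate eliminate(veto) with weighted top-truncated votes, i.e. deciding CWCM with top-truncated votes for eliminate(veto), takes polynomial time for a bounded number of candidates.
   Context: An election has a finite set $C$ of candidates and voters with non-negative integer weights; a vote of weight $w$ counts as $w$ identical votes. A top-truncated vote is a linear order over a non-empty subset of $C$; the unranked candidates are regarded as tied with each other and below all ranked ones. A complete vote ranks all of $C$ and is a special case. A voting rule assigns to each collection of votes a set of winners. The rule eliminate(veto) successively eliminates the candidate placed last (lowest score) by the veto rule, each time repeating the procedure with the reduced set of candidates (votes being restricted to the remaining candidates), until a single candidate is left. With $j$ remaining candidates the veto rule has scoring vector $\langle 1,\dots,1,0\rangle$ of length $j$: position $i$ earns the $i$-th entry. Top-truncated votes are treated analogously to rounding up: the remaining candidates listed in a vote earn the entries of their positions, the remaining unlisted candidates earn the last entry $0$, and a vote is ignored once all the candidates listed in it have been eliminated. CWCM (Constructive Weighted Coalitional Manipulation) with top-truncated votes, unique winner model: given a set $S$ of weighted votes of the non-manipulators (possibly top-truncated), the weights of a set $T$ of manipulators' votes, and a preferred candidate $p$, decide whether the votes in $T$ can be cast (each as an arbitrary top-truncated or complete vote) so that $p$ is the unique winner of the election with votes $S\cup T$. *)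

theory Defs
  imports Main "HOL-Computational_Algebra.Polynomial"
begin

section \<open>Top-truncated votes and the rule eliminate(veto)\<close>

text \<open>A top-truncated vote is the list of its ranked candidates, most preferred first. A collection
  of weighted votes is a list of pairs (vote, weight).\<close>

type_synonym 'c vote = "'c list"

definition top_truncated_vote :: "'c set \<Rightarrow> 'c vote \<Rightarrow> bool" where
  "top_truncated_vote C v \<longleftrightarrow> v \<noteq> [] \<and> distinct v \<and> set v \<subseteq> C"

definition restrict_vote :: "'c set \<Rightarrow> 'c vote \<Rightarrow> 'c vote" where
  "restrict_vote R v = filter (\<lambda>c. c \<in> R) v"

definition veto_vector :: "nat \<Rightarrow> nat list" where
  "veto_vector j = replicate (j - 1) 1 @ [0]"

text \<open>The number of candidates listed before \<open>c\<close> is the (zero-based) position of \<open>c\<close>.\<close>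

definition vote_points :: "nat list \<Rightarrow> 'c vote \<Rightarrow> 'c \<Rightarrow> nat" where
  "vote_points \<alpha> v c =
     (if c \<in> set v then \<alpha> ! length (takeWhile (\<lambda>x. x \<noteq> c) v) else last \<alpha>)"

definition veto_score :: "('c vote \<times> nat) list \<Rightarrow> 'c set \<Rightarrow> 'c \<Rightarrow> nat" where
  "veto_score V R c =
     (\<Sum>(v, w) \<leftarrow> filter (\<lambda>(v, w). restrict_vote R v \<noteq> []) V.
        w * vote_points (veto_vector (card R)) (restrict_vote R v) c)"

text \<open>If several candidates are tied for the last place, any one of them may be eliminated. The
  winners are the candidates that survive some sequence of eliminations, so \<open>p\<close> is the unique
  winner iff \<open>p\<close> is the survivor however the ties are resolved.\<close>

inductive survivor :: "('c set \<Rightarrow> 'c \<Rightarrow> nat) \<Rightarrow> 'c set \<Rightarrow> 'c \<Rightarrow> bool"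
  for score :: "'c set \<Rightarrow> 'c \<Rightarrow> nat" where
  single: "survivor score {c} c"
| eliminate: "\<lbrakk>finite R; card R \<ge> 2; d \<in> R; \<forall>e\<in>R. score R d \<le> score R e;
    survivor score (R - {d}) c\<rbrakk> \<Longrightarrow> survivor score R c"

definition eliminate_veto :: "('c vote \<times> nat) list \<Rightarrow> 'c set \<Rightarrow> 'c set" where
  "eliminate_veto V C = {c. survivor (veto_score V) C c}"

section \<open>Constructive weighted coalitional manipulation\<close>

text \<open>The candidates of an instance are the numbers \<open>0, \<dots>, ncand - 1\<close>.\<close>

record cwcm_instance =
  ncand :: nat
  preferred :: nat
  nonmanipulators :: "(nat vote \<times> nat) list"
  manipulator_weights :: "nat list"

definition valid_instance :: "cwcm_instance \<Rightarrow> bool" where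
  "valid_instance I \<longleftrightarrow> preferred I < ncand I \<and>
     (\<forall>(v, w) \<in> set (nonmanipulators I). top_truncated_vote {..<ncand I} v)"

definition manipulable :: "cwcm_instance \<Rightarrow> bool" where
  "manipulable I \<longleftrightarrow>
     (\<exists>vs. length vs = length (manipulator_weights I) \<and>
        (\<forall>v \<in> set vs. top_truncated_vote {..<ncand I} v) \<and>
        eliminate_veto (nonmanipulators I @ zip vs (manipulator_weights I)) {..<ncand I}
          = {preferred I})"

section \<open>Binary encoding of instances\<close>

fun bits :: "nat \<Rightarrow> bool list" where
  "bits n = (if n = 0 then [] else odd n # bits (n div 2))"

declare bits.simps [simp del]

text \<open>Self-delimiting: every entry is preceded by \<open>True\<close>, and \<open>False\<close> marks the end.\<close>

fun encode_list :: "('a \<Rightarrow> bool list) \<Rightarrow> 'a list \<Rightarrow> bool list" where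
  "encode_list e [] = [False]"
| "encode_list e (x # xs) = True # e x @ encode_list e xs"

definition encode_nat :: "nat \<Rightarrow> bool list" where
  "encode_nat n = encode_list (\<lambda>b. [b]) (bits n)"

definition encode_instance :: "cwcm_instance \<Rightarrow> bool list" where
  "encode_instance I =
     encode_nat (ncand I) @ encode_nat (preferred I) @
     encode_list (\<lambda>(v, w). encode_list encode_nat v @ encode_nat w) (nonmanipulators I) @
     encode_list encode_nat (manipulator_weights I)"

lemma encode_list_append_eq:
  assumes "\<And>x y r s. e x @ r = e y @ s \<Longrightarrow> x = y \<and> r = s"
  shows "encode_list e xs @ r = encode_list e ys @ s \<Longrightarrow> xs = ys \<and> r = s"
proof (induction xs arbitrary: ys)
  case Nil
  then show ?case by (cases ys) auto
next
  case (Cons x xs)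
  then show ?case by (cases ys) (auto dest!: assms)
qed

lemma bits_eq_iff: "bits m = bits n \<longleftrightarrow> m = n"
proof (induction m arbitrary: n rule: bits.induct)
  case (1 m)
  show ?case
    using 1[of "n div 2"] bits.simps[of m] bits.simps[of n]
    by (cases "m = 0"; cases "n = 0") (auto, (metis dvd_mult_div_cancel odd_two_times_div_two_succ)+)
qed

lemma encode_nat_append_eq: "encode_nat m @ r = encode_nat n @ s \<Longrightarrow> m = n \<and> r = s"
  unfolding encode_nat_def by (drule encode_list_append_eq[rotated]) (auto simp: bits_eq_iff)

lemma inj_encode_instance: "inj encode_instance"
proof (rule injI)
  fix I J :: cwcm_instance
  have vote: "v = v' \<and> r = s" if "encode_list encode_nat v @ r = encode_list encode_nat v' @ s"
    for v v' r s
    using encode_list_append_eq[OF encode_nat_append_eq that] by simp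
  have wvote: "x = y \<and> r = s"
    if "(case x of (v, w) \<Rightarrow> encode_list encode_nat v @ encode_nat w) @ r =
        (case y of (v, w) \<Rightarrow> encode_list encode_nat v @ encode_nat w) @ s"
    for x y :: "nat vote \<times> nat" and r s
    using that by (cases x; cases y) (auto dest!: vote encode_nat_append_eq)
  assume eq: "encode_instance I = encode_instance J"
  have *: "ncand I = ncand J" "preferred I = preferred J"
    and rest: "encode_list (\<lambda>(v, w). encode_list encode_nat v @ encode_nat w) (nonmanipulators I) @
        encode_list encode_nat (manipulator_weights I) =
      encode_list (\<lambda>(v, w). encode_list encode_nat v @ encode_nat w) (nonmanipulators J) @
        encode_list encode_nat (manipulator_weights J)"
    using eq unfolding encode_instance_def by (auto dest!: encode_nat_append_eq)
  have "nonmanipulators I = nonmanipulators J"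
    "encode_list encode_nat (manipulator_weights I) = encode_list encode_nat (manipulator_weights J)"
    using encode_list_append_eq[OF wvote rest] by simp_all
  moreover from this(2) have "manipulator_weights I = manipulator_weights J"
    using vote[of _ "[]" _ "[]"] by simp
  ultimately show "I = J" using * by simp
qed

definition CWCM_eliminate_veto :: "nat \<Rightarrow> bool list set" where
  "CWCM_eliminate_veto m =
     {encode_instance I | I. valid_instance I \<and> ncand I \<le> m \<and> manipulable I}"

section \<open>Polynomial time on multitape Turing machines\<close>

datatype head_move = Move_Left | Stay | Move_Right

text \<open>States and tape symbols are initial segments of the natural numbers; symbol \<open>0\<close> is the blank,
  and \<open>1\<close>, \<open>2\<close> represent the input bits. Only the part of the transition function
  constrained by \<open>wf_tm\<close>, which is finite, is ever used.\<close>

record tm =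
  tm_tapes :: nat
  tm_symbols :: nat
  tm_states :: nat
  tm_start :: nat
  tm_accept :: nat
  tm_reject :: nat
  tm_trans :: "nat \<Rightarrow> nat list \<Rightarrow> nat \<times> (nat \<times> head_move) list"

definition wf_tm :: "tm \<Rightarrow> bool" where
  "wf_tm M \<longleftrightarrow> tm_tapes M \<ge> 1 \<and> tm_symbols M \<ge> 3 \<and>
     tm_start M < tm_states M \<and> tm_accept M < tm_states M \<and> tm_reject M < tm_states M \<and>
     tm_accept M \<noteq> tm_reject M \<and>
     (\<forall>q ss. q < tm_states M \<and> length ss = tm_tapes M \<and> set ss \<subseteq> {..<tm_symbols M} \<longrightarrow>
        (case tm_trans M q ss of (q', acts) \<Rightarrow>
           q' < tm_states M \<and> length acts = tm_tapes M \<and>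
           (\<forall>(s, d) \<in> set acts. s < tm_symbols M)))"

text \<open>A tape consists of the contents of its cells and the position of its head.\<close>

type_synonym tape = "(int \<Rightarrow> nat) \<times> int"
type_synonym config = "nat \<times> tape list"

fun read_tape :: "tape \<Rightarrow> nat" where
  "read_tape (t, h) = t h"

fun act_tape :: "nat \<times> head_move \<Rightarrow> tape \<Rightarrow> tape" where
  "act_tape (s, d) (t, h) =
     (t(h := s), case d of Move_Left \<Rightarrow> h - 1 | Stay \<Rightarrow> h | Move_Right \<Rightarrow> h + 1)"

fun tm_step :: "tm \<Rightarrow> config \<Rightarrow> config" where
  "tm_step M (q, ts) =
     (if q = tm_accept M \<or> q = tm_reject M then (q, ts)
      else case tm_trans M q (map read_tape ts) of (q', acts) \<Rightarrow> (q', map2 act_tape acts ts))"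

definition input_tape :: "bool list \<Rightarrow> tape" where
  "input_tape x =
     (\<lambda>i. if 0 \<le> i \<and> i < int (length x) then (if x ! nat i then 2 else 1) else 0, 0)"

definition tm_initial :: "tm \<Rightarrow> bool list \<Rightarrow> config" where
  "tm_initial M x =
     (tm_start M, input_tape x # replicate (tm_tapes M - 1) (\<lambda>i. 0, 0))"

definition tm_decides_in_time :: "tm \<Rightarrow> (nat \<Rightarrow> nat) \<Rightarrow> bool list set \<Rightarrow> bool" where
  "tm_decides_in_time M time L \<longleftrightarrow>
     (\<forall>x. fst ((tm_step M ^^ time (length x)) (tm_initial M x))
        = (if x \<in> L then tm_accept M else tm_reject M))"

definition polynomial_time_decidable :: "bool list set \<Rightarrow> bool" where
  "polynomial_time_decidable L \<longleftrightarrow>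
     (\<exists>M (f :: nat poly). wf_tm M \<and> tm_decides_in_time M (poly f) L)"

end

theory Submission
  imports Defs "HOL-Library.Nat_Bijection"
begin

text \<open>The manipulators may as well all cast the same complete vote, namely the reverse of a suitable
  order of elimination: in each round it vetoes the candidate to be eliminated and gives every other
  candidate all the points. Hence the answer depends only on how the numbers
  \<open>N R c\<close> and \<open>N R c + W\<close> compare, where \<open>N R c\<close> is the score of
  \<open>c\<close> among the candidates \<open>R\<close> in the votes of the non-manipulators and
  \<open>W\<close> is the total weight of the manipulators; for a bounded number of candidates these
  are boundedly many numbers. A two-tape machine reads its input once from left to right, so that
  finite control suffices to recognise the votes, and adds each weight, whose bits arrive lowest
  first, to the affected counters. All counters share one work tape, each cell holding one
  binary place of every counter.\<close>

section \<open>Reduction to a single manipulator vote\<close>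

text \<open>In every round a manipulator gives each candidate at most its weight, and a complete
  vote attains this bound for all candidates but one. If arbitrary votes make \<open>p\<close> the
  unique winner, then every order of elimination that they allow ends in \<open>p\<close>, and one
  such order can be forced by common vetoes, provided that the vetoed candidate is strictly last
  each time. Strictness requires \<open>0 < W\<close>, so total weight zero is a case of its own.
  Polynomial time refers to a concrete Turing machine on binary encodings, so the obstacle is to
  leave as little as possible to the machine. The bound on the number of candidates turns everything
  combinatorial (votes, sets of remaining candidates, orders of elimination) into finite tables of
  the control; only adding and comparing numbers of unbounded length happens on the tape. One weight
  costs at most a linear pass over the counters and back, which makes the time bound
  quadratic.\<close>

lemma Diff_singleton_nonempty: "2 \<le> card R \<Longrightarrow> R - {d} \<noteq> {}"
proof
  assume "2 \<le> card R" "R - {d} = {}"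
  then have "R \<subseteq> {d}" by blast
  then have "card R \<le> card {d}" by (intro card_mono) auto
  then show False using \<open>2 \<le> card R\<close> by simp
qed

lemma two_le_card: "finite R \<Longrightarrow> R \<noteq> {} \<Longrightarrow> card R \<noteq> 1 \<Longrightarrow> 2 \<le> card R"
  by (metis One_nat_def Suc_1 Suc_leI card_gt_0_iff le_neq_implies_less)

lemma ex_minimal_score:
  fixes s :: "'c \<Rightarrow> nat"
  assumes "finite R" "R \<noteq> {}"
  obtains d where "d \<in> R" "\<forall>e\<in>R. s d \<le> s e"
  using ex_min_if_finite[of "s ` R"] assms by (auto simp: not_less)

lemma survivor_exists: "finite R \<Longrightarrow> R \<noteq> {} \<Longrightarrow> \<exists>c. survivor s R c"
proof (induction "card R" arbitrary: R rule: less_induct)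
  case less
  show ?case
  proof (cases "card R = 1")
    case True
    then show ?thesis by (auto simp: card_1_singleton_iff intro: survivor.single)
  next
    case False
    then have card: "card R \<ge> 2" using less.prems by (intro two_le_card)
    obtain d where d: "d \<in> R" "\<forall>e\<in>R. s R d \<le> s R e"
      using ex_minimal_score[OF less.prems] by blast
    have "card (R - {d}) < card R" "R - {d} \<noteq> {}"
      using card_Diff1_less[OF less.prems(1) d(1)] Diff_singleton_nonempty[OF card] by auto
    then obtain c where "survivor s (R - {d}) c" using less.hyps less.prems(1) by blast
    then show ?thesis
      using survivor.eliminate[where score = s and R = R and d = d and c = c] less.prems(1) card d
      by blast
  qed
qed

lemma survivor_singleton_iff: "survivor s {a} c \<longleftrightarrow> c = a"
  by (auto elim: survivor.cases intro: survivor.single)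

text \<open>A candidate that is last under \<open>s\<close> is also last under \<open>s'\<close>, so
  every sequence of eliminations for \<open>s\<close> is one for \<open>s'\<close>. Through
  \<open>survivor_cong\<close> this reduces the election to the order of the scores within each set
  of remaining candidates.\<close>

lemma survivor_mono:
  assumes "survivor s R c"
    and "\<And>R' d e. R' \<subseteq> R \<Longrightarrow> d \<in> R' \<Longrightarrow> e \<in> R' \<Longrightarrow> s R' d \<le> s R' e \<Longrightarrow> s' R' d \<le> s' R' e"
  shows "survivor s' R c"
  using assms
proof (induction rule: survivor.induct)
  case (single c)
  show ?case by (rule survivor.single)
next
  case (eliminate R d c)
  have "survivor s' (R - {d}) c" using eliminate.prems by (intro eliminate.IH) blast+
  then show ?case using eliminate.hyps eliminate.prems[of R] by (intro survivor.eliminate[of R d]) auto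
qed

lemma survivor_cong:
  assumes "\<And>R' d e. R' \<subseteq> R \<Longrightarrow> d \<in> R' \<Longrightarrow> e \<in> R' \<Longrightarrow> s R' d \<le> s R' e \<longleftrightarrow> s' R' d \<le> s' R' e"
  shows "survivor s R c \<longleftrightarrow> survivor s' R c"
  using assms by (auto intro: survivor_mono)

text \<open>Some candidate always survives, so unique victory of \<open>p\<close> becomes a purely
  universal statement, which suits monotonicity and induction.\<close>

lemma unique_survivor_iff:
  assumes "finite R" "R \<noteq> {}"
  shows "{c. survivor s R c} = {p} \<longleftrightarrow> (\<forall>c. survivor s R c \<longrightarrow> c = p)"
  using survivor_exists[OF assms, of s] by auto

text \<open>The score when votes of total weight \<open>W\<close> all equal the complete vote
  \<open>v\<close>: its last remaining candidate is the one vetoed.\<close>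

definition reverse_score :: "('c set \<Rightarrow> 'c \<Rightarrow> nat) \<Rightarrow> nat \<Rightarrow> 'c vote \<Rightarrow> 'c set \<Rightarrow> 'c \<Rightarrow> nat" where
  "reverse_score N W v R c = N R c + (if c \<noteq> last (restrict_vote R v) then W else 0)"

text \<open>Eliminating, among the candidates tied for the last place, one that has the fewest
  points from the non-manipulators makes it the only candidate in the last place once all
  manipulators veto it.\<close>

lemma survivor_reverse_vote:
  fixes N M :: "'c set \<Rightarrow> 'c \<Rightarrow> nat"
  assumes "finite R" "R \<noteq> {}" "0 < W"
    and "\<And>R' c. R' \<subseteq> R \<Longrightarrow> c \<in> R' \<Longrightarrow> M R' c \<le> W"
    and "\<And>c. survivor (\<lambda>R c. N R c + M R c) R c \<Longrightarrow> c = p"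
  shows "\<exists>v. distinct v \<and> set v = R \<and> (\<forall>c. survivor (reverse_score N W v) R c \<longrightarrow> c = p)"
  using assms(1,2,4,5)
proof (induction "card R" arbitrary: R rule: less_induct)
  case less
  let ?s = "\<lambda>R c. N R c + M R c"
  show ?case
  proof (cases "card R = 1")
    case True
    then obtain a where a: "R = {a}" by (auto simp: card_1_singleton_iff)
    then show ?thesis using less.prems(4)[of a]
      by (intro exI[of _ "[a]"]) (simp add: survivor_singleton_iff)
  next
    case False
    then have card: "card R \<ge> 2" using less.prems(1,2) by (intro two_le_card)
    define D where "D = {d \<in> R. \<forall>e\<in>R. ?s R d \<le> ?s R e}"
    have "finite D" using less.prems(1) by (simp add: D_def)
    moreover have "D \<noteq> {}"
      by (rule ex_minimal_score[OF less.prems(1,2), of "?s R"]) (auto simp: D_def)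
    ultimately obtain d where d: "d \<in> D" and min: "\<forall>e\<in>D. N R d \<le> N R e"
      by (rule ex_minimal_score)
    have dR: "d \<in> R" and dmin: "\<forall>e\<in>R. ?s R d \<le> ?s R e" using d by (auto simp: D_def)
    have strict: "N R d < N R e + W" if "e \<in> R" for e
    proof (cases "e \<in> D")
      case True
      then show ?thesis using bspec[OF min, of e] assms(3) by simp
    next
      \<comment> \<open>Here
        \<open>N R d <= N R e' + M R e' < N R e + M R e <= N R e + W\<close>.\<close>
      case False
      then obtain e' where "e' \<in> R" "?s R e' < ?s R e" using \<open>e \<in> R\<close> by (auto simp: D_def not_le)
      moreover have "M R e \<le> W" using less.prems(3)[of R e] \<open>e \<in> R\<close> by simp
      moreover have "?s R d \<le> ?s R e'" using dmin calculation(1) by blast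
      ultimately show ?thesis by linarith
    qed
    have "\<exists>v. distinct v \<and> set v = R - {d} \<and>
        (\<forall>c. survivor (reverse_score N W v) (R - {d}) c \<longrightarrow> c = p)"
    proof (rule less.hyps)
      show "card (R - {d}) < card R" by (rule card_Diff1_less[OF less.prems(1) dR])
      show "finite (R - {d})" using less.prems(1) by simp
      show "R - {d} \<noteq> {}" by (rule Diff_singleton_nonempty[OF card])
      show "M R' c \<le> W" if "R' \<subseteq> R - {d}" "c \<in> R'" for R' c
        using less.prems(3)[of R' c] that by blast
      show "c = p" if "survivor ?s (R - {d}) c" for c
        using survivor.eliminate[where score = ?s, OF less.prems(1) card dR dmin that]
        by (rule less.prems(4))
    qed
    then obtain v where v: "distinct v" "set v = R - {d}"
      and p: "\<And>c. survivor (reverse_score N W v) (R - {d}) c \<Longrightarrow> c = p"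
      by blast
    let ?v = "v @ [d]"
    have "c = p" if "survivor (reverse_score N W ?v) R c" for c
      using that
    proof (cases rule: survivor.cases)
      case single
      then show ?thesis using card by simp
    next
      case (eliminate d')
      have "d' = d"
      proof (rule ccontr)
        assume "d' \<noteq> d"
        then have "reverse_score N W ?v R d < reverse_score N W ?v R d'"
          using strict[OF eliminate(3)] dR by (simp add: reverse_score_def restrict_vote_def)
        moreover have "reverse_score N W ?v R d' \<le> reverse_score N W ?v R d"
          using eliminate(4) dR by blast
        ultimately show False by linarith
      qed
      \<comment> \<open>\<open>d\<close> has been eliminated, so its place at the end of the vote
        leaves the later rounds to \<open>v\<close>.\<close>
      have "restrict_vote R' ?v = restrict_vote R' v" if "R' \<subseteq> R - {d}" for R'
        using that by (auto simp: restrict_vote_def)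
      then have "survivor (reverse_score N W v) (R - {d}) c"
        using eliminate(5) unfolding \<open>d' = d\<close>
        by (elim survivor_mono) (simp add: reverse_score_def)
      then show ?thesis by (rule p)
    qed
    moreover have "distinct ?v" "set ?v = R" using v dR by auto
    ultimately show ?thesis by blast
  qed
qed

section \<open>Veto points from truncated and from complete votes\<close>

lemma last_veto_vector: "last (veto_vector j) = 0"
  by (simp add: veto_vector_def)

lemma nth_veto_vector: "i < j \<Longrightarrow> veto_vector j ! i = (if Suc i < j then 1 else 0)"
  by (auto simp: veto_vector_def nth_append)

lemma length_takeWhile_neq: "c \<in> set v \<Longrightarrow> length (takeWhile (\<lambda>x. x \<noteq> c) v) < length v"
  by (induction v) auto

lemma vote_points_veto:
  assumes "finite R" "distinct v" "set v \<subseteq> R"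
  shows "vote_points (veto_vector (card R)) v c \<le> 1"
proof -
  have "length v \<le> card R" using assms by (metis card_mono distinct_card)
  then show ?thesis using length_takeWhile_neq[of c v]
    by (auto simp: vote_points_def last_veto_vector nth_veto_vector)
qed

lemma Suc_length_takeWhile_neq:
  "distinct v \<Longrightarrow> c \<in> set v \<Longrightarrow> Suc (length (takeWhile (\<lambda>x. x \<noteq> c) v)) < length v \<longleftrightarrow> c \<noteq> last v"
  by (induction v) auto

lemma vote_points_complete:
  assumes "distinct v" "set v = R" "c \<in> R"
  shows "vote_points (veto_vector (card R)) v c = (if c \<noteq> last v then 1 else 0)"
proof -
  have "length v = card R" using assms(1,2) distinct_card by metis
  then show ?thesis
    using assms length_takeWhile_neq[of c v] Suc_length_takeWhile_neq[of v c]
    by (simp add: vote_points_def nth_veto_vector)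
qed

text \<open>A vote whose listed candidates are all gone would give everyone the last entry 0, so
  ignoring it and counting it amount to the same.\<close>

lemma veto_score_eq:
  "veto_score V R c =
     (\<Sum>(v, w)\<leftarrow>V. w * vote_points (veto_vector (card R)) (restrict_vote R v) c)"
  by (induction V) (auto simp: veto_score_def vote_points_def last_veto_vector)

lemma veto_score_append: "veto_score (V @ V') R c = veto_score V R c + veto_score V' R c"
  by (simp add: veto_score_eq)

lemma restrict_vote_complete:
  "distinct v \<Longrightarrow> R \<subseteq> set v \<Longrightarrow> distinct (restrict_vote R v) \<and> set (restrict_vote R v) = R"
  by (auto simp: restrict_vote_def)

lemma veto_score_zip_le:
  assumes "finite R" "length vs = length ws" "\<And>v. v \<in> set vs \<Longrightarrow> distinct v"
  shows "veto_score (zip vs ws) R c \<le> sum_list ws"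
  using assms(2,3)
proof (induction vs ws rule: list_induct2)
  case Nil
  then show ?case by (simp add: veto_score_eq)
next
  case (Cons v vs w ws)
  have "vote_points (veto_vector (card R)) (restrict_vote R v) c \<le> 1"
    using Cons.prems assms(1) by (intro vote_points_veto) (auto simp: restrict_vote_def)
  then have "w * vote_points (veto_vector (card R)) (restrict_vote R v) c \<le> w * 1"
    by (intro mult_left_mono) auto
  moreover have "veto_score (zip vs ws) R c \<le> sum_list ws" using Cons.prems by (intro Cons.IH) simp
  ultimately show ?case by (simp add: veto_score_eq add_mono)
qed

lemma veto_score_replicate:
  assumes "distinct v" "R \<subseteq> set v" "c \<in> R"
  shows "veto_score (zip (replicate (length ws) v) ws) R c =
    (if c \<noteq> last (restrict_vote R v) then sum_list ws else 0)"
  using vote_points_complete[of "restrict_vote R v" R c] restrict_vote_complete[OF assms(1,2)] assms(3)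
  by (induction ws) (auto simp: veto_score_eq)

text \<open>From left to right, \<open>survivor_reverse_vote\<close> is applied with the points that
  the manipulators actually give as \<open>M\<close>; \<open>veto_score_zip_le\<close> bounds them
  by the total weight. From right to left, every manipulator casts \<open>v\<close>.\<close>

lemma manipulable_iff:
  assumes "valid_instance I"
  shows "manipulable I \<longleftrightarrow> (\<exists>v. distinct v \<and> set v = {..<ncand I} \<and>
    {c. survivor (reverse_score (veto_score (nonmanipulators I)) (sum_list (manipulator_weights I)) v)
       {..<ncand I} c} = {preferred I})"
    (is "_ \<longleftrightarrow> (\<exists>v. _ \<and> _ \<and> ?wins v)")
proof -
  let ?n = "ncand I" and ?p = "preferred I" and ?ws = "manipulator_weights I"
  let ?N = "veto_score (nonmanipulators I)" and ?W = "sum_list (manipulator_weights I)"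
  have n: "finite {..<?n}" "{..<?n} \<noteq> {}" using assms by (auto simp: valid_instance_def lessThan_empty_iff)
  show ?thesis
  proof
    assume "manipulable I"
    then obtain vs where vs: "length vs = length ?ws" "\<forall>v\<in>set vs. top_truncated_vote {..<?n} v"
      and win: "eliminate_veto (nonmanipulators I @ zip vs ?ws) {..<?n} = {?p}"
      by (auto simp: manipulable_def)
    let ?M = "veto_score (zip vs ?ws)"
    have win': "c = ?p" if "survivor (\<lambda>R c. ?N R c + ?M R c) {..<?n} c" for c
    proof -
      have "c \<in> eliminate_veto (nonmanipulators I @ zip vs ?ws) {..<?n}"
        using that by (simp add: eliminate_veto_def veto_score_append[abs_def])
      then show ?thesis using win by simp
    qed
    have M: "?M R c \<le> ?W" if "R \<subseteq> {..<?n}" for R c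
      using vs finite_subset[OF that] by (intro veto_score_zip_le) (auto simp: top_truncated_vote_def)
    show "\<exists>v. distinct v \<and> set v = {..<?n} \<and> ?wins v"
    proof (cases "?W = 0")
      \<comment> \<open>Without weight the manipulators give no points, so any complete vote will
        do; the increasing order is taken.\<close>
      case True
      have M0: "?M R c = 0" if "R \<subseteq> {..<?n}" for R c using M[OF that] True by (metis le_zero_eq)
      have wins: "c = ?p" if win0: "survivor (reverse_score ?N ?W v) {..<?n} c" for v c
      proof (rule win', rule survivor_mono[OF win0])
        show "?N R d + ?M R d \<le> ?N R e + ?M R e"
          if "R \<subseteq> {..<?n}" "reverse_score ?N ?W v R d \<le> reverse_score ?N ?W v R e" for R d e
          using that(2) M0[OF that(1)] True by (simp only: reverse_score_def if_cancel add_0_right)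
      qed
      have "?wins [0..<?n]" unfolding unique_survivor_iff[OF n] by (intro allI impI) (rule wins)
      moreover have "distinct [0..<?n]" "set [0..<?n] = {..<?n}" by auto
      ultimately show ?thesis by blast
    next
      case False
      then have W: "0 < ?W" by (rule neq0_conv[THEN iffD1])
      show ?thesis unfolding unique_survivor_iff[OF n]
      proof (rule survivor_reverse_vote[OF n W, where M = ?M])
        show "?M R c \<le> ?W" if "R \<subseteq> {..<?n}" "c \<in> R" for R c using that(1) by (rule M)
        show "c = ?p" if "survivor (\<lambda>R c. ?N R c + ?M R c) {..<?n} c" for c using that by (rule win')
      qed
    qed
  next
    assume "\<exists>v. distinct v \<and> set v = {..<?n} \<and> ?wins v"
    then obtain v where v: "distinct v" "set v = {..<?n}" and win: "?wins v" by blast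
    have "survivor (veto_score (nonmanipulators I @ zip (replicate (length ?ws) v) ?ws)) {..<?n} c \<longleftrightarrow>
        survivor (reverse_score ?N ?W v) {..<?n} c" for c
    proof (rule survivor_cong)
      fix R d e
      assume "R \<subseteq> {..<?n}" "d \<in> R" "e \<in> R"
      then have "veto_score (nonmanipulators I @ zip (replicate (length ?ws) v) ?ws) R a =
          reverse_score ?N ?W v R a" if "a \<in> R" for a
        using v that by (simp only: veto_score_append veto_score_replicate reverse_score_def)
      then show "veto_score (nonmanipulators I @ zip (replicate (length ?ws) v) ?ws) R d \<le>
          veto_score (nonmanipulators I @ zip (replicate (length ?ws) v) ?ws) R e \<longleftrightarrow>
        reverse_score ?N ?W v R d \<le> reverse_score ?N ?W v R e"
        using \<open>d \<in> R\<close> \<open>e \<in> R\<close> by (simp only:)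
    qed
    then have "eliminate_veto (nonmanipulators I @ zip (replicate (length ?ws) v) ?ws) {..<?n} = {?p}"
      using win by (simp only: eliminate_veto_def)
    moreover have "v \<noteq> []" using v(2) n(2) by force
    then have "top_truncated_vote {..<?n} v" using v by (simp add: top_truncated_vote_def)
    then have "\<forall>v'\<in>set (replicate (length ?ws) v). top_truncated_vote {..<?n} v'" by simp
    ultimately show "manipulable I"
      unfolding manipulable_def using length_replicate[of "length ?ws" v] by blast
  qed
qed

section \<open>Machines that add weights to counters\<close>

lemma encode_nat_0 [simp]: "encode_nat 0 = [False]"
  by (simp add: encode_nat_def bits.simps)

lemma encode_nat_pos: "0 < n \<Longrightarrow> encode_nat n = True # odd n # encode_nat (n div 2)"
  by (simp add: encode_nat_def bits.simps[of n])

text \<open>\<open>f\<close> is a continuation that receives the number and the rest of the input.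
  \<open>l\<close> tells whether the number may end here: \<open>bits\<close> never ends with a
  zero, so the last bit must be \<open>True\<close>. Starting with \<open>l = True\<close> admits
  the empty word of digits, which is the number 0.\<close>

fun parse_weight :: "(nat \<Rightarrow> bool list \<Rightarrow> bool) \<Rightarrow> bool \<Rightarrow> bool list \<Rightarrow> bool" where
  "parse_weight f l (False # xs) = (l \<and> f 0 xs)"
| "parse_weight f l (True # b # xs) = parse_weight (\<lambda>w. f (of_bool b + 2 * w)) b xs"
| "parse_weight f l _ = False"

lemma parse_weight_iff:
  "parse_weight f l xs \<longleftrightarrow> (\<exists>w ys. xs = encode_nat w @ ys \<and> f w ys \<and> (w = 0 \<longrightarrow> l))"
proof (induction f l xs rule: parse_weight.induct)
  case (1 f l xs)
  have "w = 0 \<and> ys = xs" if "False # xs = encode_nat w @ ys" for w ys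
    using that by (cases "w = 0") (auto simp: encode_nat_pos)
  then show ?case
    by (metis append_Cons append_Nil encode_nat_0 parse_weight.simps(1))
next
  case (2 f l b xs)
  show ?case
  proof
    assume "parse_weight f l (True # b # xs)"
    then obtain w ys where w: "xs = encode_nat w @ ys" "f (of_bool b + 2 * w) ys" "w = 0 \<longrightarrow> b"
      using 2 by auto
    have "True # b # xs = encode_nat (of_bool b + 2 * w) @ ys"
      using w by (subst encode_nat_pos) auto
    then show "\<exists>w ys. True # b # xs = encode_nat w @ ys \<and> f w ys \<and> (w = 0 \<longrightarrow> l)"
      using w by (intro exI[of _ "of_bool b + 2 * w"] exI[of _ ys]) auto
  next
    assume "\<exists>w ys. True # b # xs = encode_nat w @ ys \<and> f w ys \<and> (w = 0 \<longrightarrow> l)"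
    then obtain w ys where w: "True # b # xs = encode_nat w @ ys" "f w ys"
      by auto
    then have pos: "0 < w" by (cases "w = 0") auto
    have b: "b = odd w" "xs = encode_nat (w div 2) @ ys"
      using w(1) pos by (auto simp: encode_nat_pos)
    have "of_bool b + 2 * (w div 2) = w" by (simp add: b)
    moreover have "w div 2 = 0 \<longrightarrow> b" using pos b
      by (metis calculation add.right_neutral mult_0_right of_bool_eq(1) neq0_conv)
    ultimately show "parse_weight f l (True # b # xs)"
      unfolding parse_weight.simps 2 using b(2) w(2)
      by (intro exI[of _ "w div 2"] exI[of _ ys]) simp
  qed
next
  case ("3_1" f l)
  then show ?case by (auto simp: encode_nat_def elim: encode_list.elims)
next
  case ("3_2" f l)
  have "[True] \<noteq> encode_nat w @ ys" for w ys
    by (cases "w = 0") (auto simp: encode_nat_pos)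
  then show ?case by simp
qed

text \<open>The work tape is kept as a zipper: the cells left of the head, nearest first, and the cells
  from the head on; cells outside the two lists are blank.\<close>

definition cell :: "nat list \<Rightarrow> nat \<Rightarrow> nat" where
  "cell R j = (if j < length R then R ! j else 0)"

text \<open>A blank pushed onto an empty side leaves it empty, so stepping onto the blank beyond the
  left end and back restores the zipper.\<close>

definition cons_cell :: "nat \<Rightarrow> nat list \<Rightarrow> nat list" where
  "cons_cell s R = (if s = 0 \<and> R = [] then [] else s # R)"

lemma cell_simps [simp]:
  "cell [] j = 0" "cell (s # R) 0 = s" "cell (s # R) (Suc j) = cell R j"
  "cell (tl R) j = cell R (Suc j)"
  "cell (cons_cell s R) 0 = s" "cell (cons_cell s R) (Suc j) = cell R j"
  by (auto simp: cell_def cons_cell_def nth_tl)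

lemma cons_cell_simps [simp]:
  "tl (cons_cell s R) = R" "s \<noteq> 0 \<Longrightarrow> cons_cell s R = s # R" "cons_cell 0 [] = []"
  "cons_cell s (x # R) = s # x # R"
  by (auto simp: cons_cell_def)

lemma cons_cell_cell [simp]: "cons_cell (cell R 0) (tl R) = R" if "0 \<notin> set R"
  using that by (cases R) (auto simp: cons_cell_def)

fun move_head :: "head_move \<Rightarrow> nat list \<times> nat list \<Rightarrow> nat list \<times> nat list" where
  "move_head Move_Left (L, R) = (tl L, cons_cell (cell L 0) R)"
| "move_head Stay (L, R) = (L, R)"
| "move_head Move_Right (L, R) = (cons_cell (cell R 0) L, tl R)"

definition zipper_tape :: "nat list \<Rightarrow> nat list \<Rightarrow> tape \<Rightarrow> bool" where
  "zipper_tape L R T \<longleftrightarrow> (case T of (t, h) \<Rightarrow>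
     (\<forall>j. t (h + int j) = cell R j) \<and> (\<forall>j. t (h - 1 - int j) = cell L j))"

lemma zipper_tape_act:
  assumes "zipper_tape L R T" "move_head d (L, cons_cell s (tl R)) = (L', R')"
  shows "zipper_tape L' R' (act_tape (s, d) T)"
proof -
  obtain t h where T: "T = (t, h)" by (cases T)
  have R: "t (h + int j) = cell R j" and L: "t (h - 1 - int j) = cell L j" for j
    using assms(1) by (auto simp: zipper_tape_def T)
  let ?R = "cons_cell s (tl R)" and ?t = "t(h := s)"
  have R1: "?t (h + int j) = cell ?R j" for j
    using R[of j] by (cases j) auto
  have L1: "?t (h - 1 - int j) = cell L j" for j
    using L[of j] by auto
  show ?thesis
  proof (cases d)
    case Move_Left
    have "?t (h - 1 + int j) = cell (cons_cell (cell L 0) ?R) j" for j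
      using L1[of 0] R1[of "j - 1"] by (cases j) (auto simp: algebra_simps)
    moreover have "?t (h - 1 - 1 - int j) = cell (tl L) j" for j
      using L1[of "Suc j"] by (auto simp: algebra_simps)
    ultimately show ?thesis using assms(2) Move_Left
      by (auto simp: zipper_tape_def T)
  next
    case Stay
    then show ?thesis using assms(2) R1 L1 by (auto simp: zipper_tape_def T)
  next
    case Move_Right
    have "?t (h + 1 + int j) = cell (tl ?R) j" for j
      using R1[of "Suc j"] by (auto simp: algebra_simps)
    moreover have "?t (h + 1 - 1 - int j) = cell (cons_cell (cell ?R 0) L) j" for j
      using R1[of 0] L1[of "j - 1"] by (cases j) (auto simp: algebra_simps)
    ultimately show ?thesis using assms(2) Move_Right
      by (auto simp: zipper_tape_def T) (metis less_irrefl)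
  qed
qed

text \<open>A non-blank symbol of the work tape is a set of counters: those that have a one at this
  binary place. A blank reads as the empty set.\<close>

definition enc :: "nat set \<Rightarrow> nat" where
  "enc X = Suc (set_encode X)"

definition dec :: "nat \<Rightarrow> nat set" where
  "dec s = set_decode (s - 1)"

lemma dec_enc [simp]: "finite X \<Longrightarrow> dec (enc X) = X"
  by (simp add: dec_def enc_def)

lemma enc_neq_0 [simp]: "enc X \<noteq> 0" "0 \<noteq> enc X" by (simp_all add: enc_def)

lemma dec_0 [simp]: "dec 0 = {}" by (simp add: dec_def)

lemma finite_dec [simp]: "finite (dec s)" by (simp add: dec_def)

lemma dec_subset: "s < 2 ^ k + 1 \<Longrightarrow> dec s \<subseteq> {..<k}"
proof
  fix i assume s: "s < 2 ^ k + 1" and i: "i \<in> dec s"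
  have "2 ^ i \<le> s - 1"
    using i by (auto simp: dec_def set_decode_def intro: ccontr)
  also have "s - 1 < 2 ^ k" using s by (cases s) auto
  finally show "i \<in> {..<k}" by simp
qed

lemma enc_less: "X \<subseteq> {..<k} \<Longrightarrow> enc X < 2 ^ k + 1"
proof -
  assume "X \<subseteq> {..<k}"
  then have "set_encode X \<le> (\<Sum>i<k. 2 ^ i)"
    unfolding set_encode_def by (intro sum_mono2) auto
  also have "\<dots> < 2 ^ k" by (simp add: mask_eq_sum_exp_nat[symmetric] lessThan_def)
  finally show ?thesis by (simp add: enc_def)
qed

fun counter :: "nat \<Rightarrow> nat list \<Rightarrow> nat" where
  "counter i [] = 0"
| "counter i (s # R) = of_bool (i \<in> dec s) + 2 * counter i R"

text \<open>The value of counter \<open>i\<close> when its places left of the head are in \<open>L\<close>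
  and the rest of it has the value \<open>v\<close>.\<close>

fun zip_counter :: "nat \<Rightarrow> nat list \<Rightarrow> nat \<Rightarrow> nat" where
  "zip_counter i [] v = v"
| "zip_counter i (s # L) v = zip_counter i L (of_bool (i \<in> dec s) + 2 * v)"

lemma counter_rev_append: "counter i (rev L @ R) = zip_counter i L (counter i R)"
  by (induction L arbitrary: R) auto

lemma counter_cell: "counter i R = of_bool (i \<in> dec (cell R 0)) + 2 * counter i (tl R)"
  by (cases R) auto

text \<open>Together with \<open>carry_set\<close> this is a full adder for all counters in
  parallel: the nested equivalence of three truth values is their parity, the carry their
  majority.\<close>

definition sum_set :: "nat set \<Rightarrow> nat set \<Rightarrow> nat set \<Rightarrow> nat set" where
  "sum_set X Y Z = {i \<in> X \<union> Y \<union> Z. (i \<in> X) = ((i \<in> Y) = (i \<in> Z))}"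

definition carry_set :: "nat set \<Rightarrow> nat set \<Rightarrow> nat set \<Rightarrow> nat set" where
  "carry_set X Y Z = X \<inter> Y \<union> X \<inter> Z \<union> Y \<inter> Z"

lemma sum_set_carry_set:
  "of_bool (i \<in> sum_set X Y Z) + 2 * of_bool (i \<in> carry_set X Y Z) =
     of_bool (i \<in> X) + of_bool (i \<in> Y) + (of_bool (i \<in> Z) :: nat)"
  by (auto simp: sum_set_def carry_set_def)

lemma finite_sum_set [simp]:
  "finite X \<Longrightarrow> finite Y \<Longrightarrow> finite Z \<Longrightarrow> finite (sum_set X Y Z)"
  "finite X \<Longrightarrow> finite Y \<Longrightarrow> finite Z \<Longrightarrow> finite (carry_set X Y Z)"
  by (auto simp: sum_set_def carry_set_def)

definition comparisons :: "nat \<Rightarrow> (nat \<Rightarrow> nat) \<Rightarrow> (nat \<times> nat) set" where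
  "comparisons k cnt = {(i, j). i < k \<and> j < k \<and> cnt i \<le> cnt j}"

datatype 'p action = Goto 'p | Weight "nat set" 'p | Finish 'p

text \<open>\<open>Read\<close> stores the part of a code word read so far. In \<open>Mark\<close>
  and \<open>Bit\<close> the first set consists of the counters that receive the weight, the second
  of those with a pending carry, as in \<open>Carry\<close>; the flag of \<open>Mark\<close> is that
  of \<open>parse_weight\<close>. \<open>Compare\<close> stores the order of the counters according
  to the places scanned so far.\<close>

datatype 'p state =
    Acc
  | Rej
  | Read 'p "bool list"
  | Mark "nat set" 'p "nat set" bool
  | Bit "nat set" 'p "nat set"
  | Carry 'p "nat set"
  | Rewind 'p
  | Compare 'p "(nat \<times> nat) set"

text \<open>An input consists of blocks. In phase \<open>ph\<close> a block starts with a word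
  \<open>u\<close> such that \<open>code ph u a\<close>; if \<open>a = Weight S ph'\<close>, then an encoded number
  follows, which is added to the counters in \<open>S\<close>. The verdict at the end of the input sees
  only the order of the counters.\<close>

locale weight_counting =
  fixes code :: "'p \<Rightarrow> bool list \<Rightarrow> 'p action \<Rightarrow> bool"
    and verdict :: "'p \<Rightarrow> (nat \<times> nat) set \<Rightarrow> bool"
    and k :: nat
    and P :: "'p set"
    and start :: 'p
  assumes k_pos: "0 < k"
    and finite_P: "finite P"
    and start_P: "start \<in> P"
    and finite_code: "ph \<in> P \<Longrightarrow> finite {u. \<exists>a. code ph u a}"
    and code_P: "ph \<in> P \<Longrightarrow> code ph u a \<Longrightarrow> set_action a \<subseteq> P"
    and code_Weight: "code ph u (Weight S ph') \<Longrightarrow> S \<subseteq> {..<k}"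
    and code_nonempty: "\<not> code ph [] a"
    and code_prefix_free: "code ph u a \<Longrightarrow> code ph u' a' \<Longrightarrow> u @ x = u' @ y \<Longrightarrow> u = u' \<and> a = a'"
begin

inductive accepted :: "'p \<Rightarrow> (nat \<Rightarrow> nat) \<Rightarrow> bool list \<Rightarrow> bool" where
  goto: "code ph u (Goto ph') \<Longrightarrow> accepted ph' cnt xs \<Longrightarrow> accepted ph cnt (u @ xs)"
| weight: "code ph u (Weight S ph') \<Longrightarrow> accepted ph' (\<lambda>i. cnt i + of_bool (i \<in> S) * w) xs \<Longrightarrow>
    accepted ph cnt (u @ encode_nat w @ xs)"
| finish: "code ph u (Finish ph') \<Longrightarrow> verdict ph' (comparisons k cnt) \<Longrightarrow> accepted ph cnt u"

text \<open>Before any place is scanned all counters look equal, hence the full relation in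
  \<open>Compare\<close>. An addition starts without carries.\<close>

fun entry :: "'p action \<Rightarrow> 'p state" where
  "entry (Goto ph) = Read ph []"
| "entry (Weight S ph) = Mark S ph {} True"
| "entry (Finish ph) = Compare ph ({..<k} \<times> {..<k})"

text \<open>A word that cannot be completed to a code word is rejected at once, so only prefixes of
  finitely many code words need states.\<close>

definition after_read :: "'p \<Rightarrow> bool list \<Rightarrow> 'p state" where
  "after_read ph u =
     (if \<exists>a. code ph u a then entry (THE a. code ph u a)
      else if \<exists>z a. code ph (u @ z) a then Read ph u else Rej)"

text \<open>Numbers are scanned from the lowest place, so a later difference overrides.\<close>

definition compare_set :: "nat set \<Rightarrow> (nat \<times> nat) set \<Rightarrow> (nat \<times> nat) set" where
  "compare_set X r =
     {(i, j) \<in> {..<k} \<times> {..<k}. if (i \<in> X) = (j \<in> X) then (i, j) \<in> r else j \<in> X}"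

text \<open>Only \<open>Read\<close>, \<open>Mark\<close> and \<open>Bit\<close> consume input.
  \<open>Rewind\<close> recognises the left end by its blank, since \<open>enc\<close> never yields
  0. The last equation rejects input that ends too early, and input left over in
  \<open>Compare\<close>.\<close>

fun delta :: "'p state \<Rightarrow> bool option \<Rightarrow> nat \<Rightarrow> 'p state \<times> bool \<times> nat \<times> head_move" where
  "delta (Read ph u) (Some b) s = (after_read ph (u @ [b]), True, s, Stay)"
| "delta (Mark S ph c l) (Some b) s =
     (if b then Bit S ph c else if l then Carry ph c else Rej, True, s, Stay)"
| "delta (Bit S ph c) (Some b) s =
     (Mark S ph (carry_set (dec s) c (if b then S else {})) b, True,
      enc (sum_set (dec s) c (if b then S else {})), Move_Right)"
| "delta (Carry ph c) _ s =
     (if c = {} then (Rewind ph, False, s, Move_Left)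
      else (Carry ph (carry_set (dec s) c {}), False, enc (sum_set (dec s) c {}), Move_Right))"
| "delta (Rewind ph) _ s =
     (if s = 0 then (Read ph [], False, s, Move_Right) else (Rewind ph, False, s, Move_Left))"
| "delta (Compare ph r) None s =
     (if s = 0 then (if verdict ph r then Acc else Rej, False, s, Stay)
      else (Compare ph (compare_set (dec s) r), False, s, Move_Right))"
| "delta _ _ s = (Rej, False, s, Stay)"

fun step :: "'p state \<times> bool list \<times> nat list \<times> nat list \<Rightarrow> 'p state \<times> bool list \<times> nat list \<times> nat list"
  where
  "step (q, xs, L, R) =
     (if q = Acc \<or> q = Rej then (q, xs, L, R)
      else case delta q (if xs = [] then None else Some (hd xs)) (cell R 0) of
        (q', adv, s, d) \<Rightarrow>
          (q', if adv then tl xs else xs, move_head d (L, cons_cell s (tl R))))"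

section \<open>Correctness and running time of the abstract machine\<close>

definition halts :: "nat \<Rightarrow> 'p state \<times> bool list \<times> nat list \<times> nat list \<Rightarrow> bool \<Rightarrow> bool" where
  "halts t c b \<longleftrightarrow> fst ((step ^^ t) c) = (if b then Acc else Rej)"

lemma halts_final:
  assumes "fst c = (if b then Acc else Rej)"
  shows "halts t c b"
proof -
  have "step c = c" using assms by (cases c) auto
  then have "(step ^^ t) c = c" by (induction t) auto
  then show ?thesis using assms by (simp add: halts_def)
qed

lemma halts_Rej: "\<not> b \<Longrightarrow> halts t (Rej, c) b" by (rule halts_final) auto

lemma halts_add: "halts (s + t) c b \<longleftrightarrow> halts t ((step ^^ s) c) b"
  by (simp add: halts_def funpow_add add.commute[of s])

lemma halts_mono: "halts s c b \<Longrightarrow> s \<le> t \<Longrightarrow> halts t c b"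
  using halts_add[of s "t - s"] halts_final by (auto simp: halts_def)

lemma halts_step: "halts s (step c) b \<Longrightarrow> s < t \<Longrightarrow> halts t c b"
  by (rule halts_mono[of "Suc s"]) (use halts_add[of 1 s] in auto)

text \<open>The configuration in the conclusion arises from \<open>(L, R)\<close> by one move to the
  left. Each cell of \<open>L\<close> takes one step, and the blank beyond it the last one.\<close>

lemma halts_Rewind:
  assumes "0 \<notin> set L" "halts t (Read ph [], xs, [], rev L @ R) b"
  shows "halts (t + length L + 1) (Rewind ph, xs, tl L, cons_cell (cell L 0) R) b"
  using assms
proof (induction L arbitrary: R)
  case Nil
  then show ?case by - (rule halts_step[of t], auto simp: cons_cell_def)
next
  case (Cons s L)
  have "halts (t + length L + 1) (Rewind ph, xs, tl L, cons_cell (cell L 0) (s # R)) b"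
    using Cons.IH[of "s # R"] Cons.prems by simp
  then show ?case using Cons.prems
    by - (rule halts_step[of "t + length L + 1"], auto)
qed

lemma halts_Carry_empty:
  assumes "0 \<notin> set L" "0 \<notin> set R" "halts t (Read ph [], xs, [], rev L @ R) b"
  shows "halts (t + length L + 2) (Carry ph {}, xs, L, R) b"
  using halts_Rewind[OF assms(1,3)] assms(2)
  by - (rule halts_step[of "t + length L + 1"], auto)

text \<open>Each cell of \<open>R\<close> costs at most one step for the carry and one on the way
  back. The 4 pays for one new cell at the end, again counted twice, for the step that finds no
  carry left, and for the turn at the blank.\<close>

lemma halts_Carry:
  assumes "0 \<notin> set L" "0 \<notin> set R" "finite c"
    and "\<And>R'. 0 \<notin> set R' \<Longrightarrow> length R' \<le> length L + length R + 1 \<Longrightarrow>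
      (\<And>i. counter i R' = zip_counter i L (counter i R + of_bool (i \<in> c))) \<Longrightarrow>
      halts t (Read ph [], xs, [], R') b"
  shows "halts (t + length L + 2 * length R + 4) (Carry ph c, xs, L, R) b"
  using assms
proof (induction R arbitrary: L c)
  case Nil
  show ?case
  proof (cases "c = {}")
    case True
    have "halts (t + length L + 2) (Carry ph {}, xs, L, []) b"
      using Nil counter_rev_append[of _ L "[]"] True by (intro halts_Carry_empty Nil(4)) auto
    then show ?thesis using True by (auto elim: halts_mono)
  next
    case False
    let ?L = "enc (sum_set {} c {}) # L"
    have s: "sum_set {} c {} = c" "carry_set {} c {} = {}"
      by (auto simp: sum_set_def carry_set_def)
    have "halts (t + length ?L + 2) (Carry ph {}, xs, ?L, []) b"
      using Nil s by (intro halts_Carry_empty Nil(4)) (auto simp: counter_rev_append)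
    then show ?thesis using False s by - (rule halts_step[of "t + length ?L + 2"], auto)
  qed
next
  case (Cons s R)
  show ?case
  proof (cases "c = {}")
    case True
    then show ?thesis using Cons.prems
      by (auto intro!: halts_mono[OF halts_Carry_empty[of _ _ t]] Cons.prems(4) simp: counter_rev_append)
  next
    case False
    let ?c = "carry_set (dec s) c {}" and ?s = "sum_set (dec s) c {}"
    have val: "zip_counter i (enc ?s # L) (counter i R + of_bool (i \<in> ?c)) =
        zip_counter i L (counter i (s # R) + of_bool (i \<in> c))" for i
      using sum_set_carry_set[of i "dec s" c "{}"] Cons.prems(3) by (simp add: algebra_simps)
    have "halts (t + length (enc ?s # L) + 2 * length R + 4) (Carry ph ?c, xs, enc ?s # L, R) b"
      using Cons.prems val by (intro Cons.IH) auto
    then show ?thesis using False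
      by - (rule halts_step[of "t + length (enc ?s # L) + 2 * length R + 4"], auto)
  qed
qed

text \<open>The time allowed is \<open>K\<close> per remaining input bit. The bit that ends a weight
  pays for the carry propagation and for rewinding the work tape. An encoded weight has more bits
  than it can add places to the counters, so \<open>D\<close> bounds the number of remaining bits and
  places throughout.\<close>

lemma halts_Mark:
  assumes "0 \<notin> set L" "0 \<notin> set R" "finite c" "finite S" "length xs + length L + length R \<le> D"
    and "2 * D + 10 \<le> K"
    and "\<And>R' w ys. 0 \<notin> set R' \<Longrightarrow> length ys + length R' \<le> D \<Longrightarrow> length ys < length xs \<Longrightarrow>
      (\<And>i. counter i R' =
        zip_counter i L (counter i R + of_bool (i \<in> c) + of_bool (i \<in> S) * w)) \<Longrightarrow>
      halts (Suc (length ys) * K) (Read ph [], ys, [], R') (f w ys)"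
  shows "halts (Suc (length xs) * K) (Mark S ph c l, xs, L, R) (parse_weight f l xs)"
  using assms
proof (induction f l xs arbitrary: L R c rule: parse_weight.induct)
  case (1 f l xs)
  let ?t = "Suc (length xs) * K"
  show ?case
  proof (cases l)
    case True
    have "halts (?t + length L + 2 * length R + 4) (Carry ph c, xs, L, R) (f 0 xs)"
    proof (rule halts_Carry)
      show "halts ?t (Read ph [], xs, [], R') (f 0 xs)"
        if "0 \<notin> set R'" "length R' \<le> length L + length R + 1"
          "\<And>i. counter i R' = zip_counter i L (counter i R + of_bool (i \<in> c))" for R'
        using that 1(5) by (intro 1(7)) auto
    qed (fact 1(1-3))+
    \<comment> \<open>The bit that ends the weight is worth one \<open>K\<close>, and
      \<open>length L + 2 * length R + 4 < 2 * D + 10 <= K\<close>.\<close>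
    moreover have "?t + length L + 2 * length R + 4 < Suc (length (False # xs)) * K"
      using 1(5,6) by simp
    moreover have "step (Mark S ph c l, False # xs, L, R) = (Carry ph c, xs, L, R)"
      using 1(2) True by simp
    ultimately have "halts (Suc (length (False # xs)) * K) (Mark S ph c l, False # xs, L, R) (f 0 xs)"
      by - (rule halts_step[of "?t + length L + 2 * length R + 4"], simp_all only:)
    then show ?thesis using True by (simp only: parse_weight.simps simp_thms)
  next
    case False
    then have "halts 0 (step (Mark S ph c l, False # xs, L, R)) False"
      by (simp add: halts_Rej)
    then show ?thesis using False 1(6) by (auto elim: halts_step simp del: step.simps)
  qed
next
  case (2 f l b xs)
  let ?Y = "if b then S else {}"
  let ?s = "sum_set (dec (cell R 0)) c ?Y" and ?c = "carry_set (dec (cell R 0)) c ?Y"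
  let ?t = "Suc (length xs) * K"
  \<comment> \<open>The number read is \<open>of_bool b + 2 * w\<close>: the adder at the current
    cell deals with its lowest digit, and \<open>w\<close> is left to the higher places.\<close>
  have val: "zip_counter i (enc ?s # L)
        (counter i (tl R) + of_bool (i \<in> ?c) + of_bool (i \<in> S) * w) =
      zip_counter i L (counter i R + of_bool (i \<in> c) + of_bool (i \<in> S) * (of_bool b + 2 * w))"
    for i w
  proof -
    have "of_bool (i \<in> ?Y) = of_bool (i \<in> S) * (of_bool b :: nat)" by auto
    then have "of_bool (i \<in> ?s) + 2 * (counter i (tl R) + of_bool (i \<in> ?c) + of_bool (i \<in> S) * w) =
        counter i R + of_bool (i \<in> c) + of_bool (i \<in> S) * (of_bool b + 2 * w)"
      unfolding counter_cell[of i R] distrib_left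
      using sum_set_carry_set[of i "dec (cell R 0)" c ?Y] by linarith
    moreover have "dec (enc ?s) = ?s" using 2(4,5) by simp
    ultimately show ?thesis by (simp only: zip_counter.simps)
  qed
  have "halts ?t (Mark S ph ?c b, xs, enc ?s # L, tl R) (parse_weight f l (True # b # xs))"
    unfolding parse_weight.simps
  proof (intro 2(1))
    show "0 \<notin> set (enc ?s # L)" "0 \<notin> set (tl R)" "finite ?c" "finite S"
      using 2(2-5) by (cases R; auto)+
    show "length xs + length (enc ?s # L) + length (tl R) \<le> D" "2 * D + 10 \<le> K" using 2(6,7) by auto
    show "halts (Suc (length ys) * K) (Read ph [], ys, [], R') (f (of_bool b + 2 * w) ys)"
      if "0 \<notin> set R'" "length ys + length R' \<le> D" "length ys < length xs"
        "\<And>i. counter i R' = zip_counter i (enc ?s # L)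
           (counter i (tl R) + of_bool (i \<in> ?c) + of_bool (i \<in> S) * w)" for R' w ys
      using that unfolding val by (intro 2(8)) auto
  qed
  moreover have "step (step (Mark S ph c l, True # b # xs, L, R)) =
      (Mark S ph ?c b, xs, enc ?s # L, tl R)"
    by simp
  ultimately have "halts (Suc ?t) (step (Mark S ph c l, True # b # xs, L, R))
      (parse_weight f l (True # b # xs))"
    by - (rule halts_step[of ?t], simp_all only:)
  then show ?case
    by (rule halts_step) (use 2(7) in simp)
next
  case ("3_1" f l)
  have "halts 0 (step (Mark S ph c l, [], L, R)) False" by (simp add: halts_Rej)
  then show ?case using "3_1"(6) by (auto elim: halts_step simp del: step.simps)
next
  case ("3_2" f l)
  have "halts 0 (step (step (Mark S ph c l, [True], L, R))) False" by (simp add: halts_Rej)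
  then have "halts 1 (step (Mark S ph c l, [True], L, R)) False" by (rule halts_step) simp
  then show ?case using "3_2"(6) by (auto elim: halts_step simp del: step.simps)
qed

text \<open>A lexicographic invariant: what remains in \<open>R\<close> has precedence, and
  \<open>r\<close>, which stands for the lower places, breaks ties.\<close>

lemma halts_Compare:
  assumes "0 \<notin> set R" "\<And>i j. (i, j) \<in> r \<Longrightarrow> i < k \<and> j < k"
  shows "halts (length R + 1) (Compare ph r, xs, L, R)
    (xs = [] \<and> verdict ph {(i, j). i < k \<and> j < k \<and>
       (counter i R < counter j R \<or> counter i R = counter j R \<and> (i, j) \<in> r)})"
  using assms
proof (induction R arbitrary: r L)
  case Nil
  then have "{(i, j). i < k \<and> j < k \<and> (i, j) \<in> r} = r" by auto
  then show ?case by - (rule halts_step[of 0], auto intro: halts_final)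
next
  case (Cons s R)
  show ?case
  proof (cases "xs = []")
    case False
    then show ?thesis by - (rule halts_step[of 0], auto intro: halts_Rej simp: neq_Nil_conv)
  next
    case True
    let ?r = "compare_set (dec s) r"
    have "counter i R < counter j R \<or> counter i R = counter j R \<and> (i, j) \<in> ?r \<longleftrightarrow>
        counter i (s # R) < counter j (s # R) \<or>
          counter i (s # R) = counter j (s # R) \<and> (i, j) \<in> r" if "i < k" "j < k" for i j
      using that by (cases "i \<in> dec s"; cases "j \<in> dec s"; simp add: compare_set_def; arith)
    then have "{(i, j). i < k \<and> j < k \<and>
         (counter i R < counter j R \<or> counter i R = counter j R \<and> (i, j) \<in> ?r)} =
      {(i, j). i < k \<and> j < k \<and>
         (counter i (s # R) < counter j (s # R) \<or>
          counter i (s # R) = counter j (s # R) \<and> (i, j) \<in> r)}"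
      by blast
    moreover have "halts (length R + 1) (Compare ph ?r, xs, s # L, R)
      (xs = [] \<and> verdict ph {(i, j). i < k \<and> j < k \<and>
         (counter i R < counter j R \<or> counter i R = counter j R \<and> (i, j) \<in> ?r)})"
      using Cons.prems by (intro Cons.IH) (auto simp: compare_set_def)
    ultimately show ?thesis using Cons.prems True
      by - (rule halts_step[of "length R + 1"], auto)
  qed
qed

text \<open>Prefix-freeness leaves \<open>u\<close> as the only block with which a derivation of
  acceptance can begin.\<close>

lemma accepted_code_iff:
  assumes "code ph u a"
  shows "accepted ph cnt (u @ xs) \<longleftrightarrow> (case a of
      Goto ph' \<Rightarrow> accepted ph' cnt xs
    | Weight S ph' \<Rightarrow>
        parse_weight (\<lambda>w. accepted ph' (\<lambda>i. cnt i + of_bool (i \<in> S) * w)) True xs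
    | Finish ph' \<Rightarrow> xs = [] \<and> verdict ph' (comparisons k cnt))"
    (is "_ \<longleftrightarrow> ?r")
proof
  assume "accepted ph cnt (u @ xs)"
  then show ?r
  proof (cases rule: accepted.cases)
    case (goto u' ph' xs')
    then show ?thesis using code_prefix_free[OF assms goto(2) goto(1)] by auto
  next
    case (weight u' S ph' w xs')
    then show ?thesis using code_prefix_free[OF assms weight(2) weight(1)]
      by (auto simp: parse_weight_iff)
  next
    case (finish ph')
    then show ?thesis using code_prefix_free[OF assms finish(1), of xs "[]"] by auto
  qed
next
  assume ?r
  then show "accepted ph cnt (u @ xs)"
    using assms by (auto simp: parse_weight_iff intro: accepted.intros split: action.splits)
qed

lemma accepted_imp_code:
  assumes "accepted ph cnt xs"
  obtains u ys a where "xs = u @ ys" "code ph u a"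
  using assms by (cases rule: accepted.cases) (auto, metis append_Nil2)

text \<open>The last assumption says that no block has ended within \<open>u\<close>,
  \<open>u\<close> itself included, so that no earlier way of splitting off a block has been
  missed.\<close>

lemma halts_Read:
  assumes "0 \<notin> set R" "length xs + length R \<le> D" "2 * D + 10 \<le> K"
    and "\<And>u' z a. u = u' @ z \<Longrightarrow> \<not> code ph u' a"
  shows "halts (Suc (length xs) * K) (Read ph u, xs, [], R)
    (accepted ph (\<lambda>i. counter i R) (u @ xs))"
  using assms
proof (induction "length xs" arbitrary: ph u xs R rule: less_induct)
  case less
  show ?case
  proof (cases xs)
    case Nil
    have "\<not> accepted ph (\<lambda>i. counter i R) (u @ xs)"
      using less.prems(4) Nil by (auto elim!: accepted_imp_code)
    moreover have "halts 0 (step (Read ph u, xs, [], R)) False" using Nil by (simp add: halts_Rej)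
    ultimately show ?thesis using less.prems(3) by (auto elim: halts_step simp del: step.simps)
  next
    case (Cons b ys)
    let ?u = "u @ [b]"
    have "halts (Suc (length ys) * K) (after_read ph ?u, ys, [], R)
      (accepted ph (\<lambda>i. counter i R) (?u @ ys))"
    proof (cases "\<exists>a. code ph ?u a")
      case True
      then obtain a where a: "code ph ?u a" by auto
      then have "(THE a. code ph ?u a) = a"
        using code_prefix_free by blast
      then have after: "after_read ph ?u = entry a" using a by (auto simp: after_read_def)
      show ?thesis
      proof (cases a)
        case (Goto ph')
        have "halts (Suc (length ys) * K) (Read ph' [], ys, [], R)
          (accepted ph' (\<lambda>i. counter i R) ([] @ ys))"
          using less.prems Cons code_nonempty by (intro less.hyps) auto
        then show ?thesis using accepted_code_iff[OF a] after Goto by simp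
      next
        case (Weight S ph')
        have "finite S" using code_Weight a Weight by (metis finite_lessThan finite_subset)
        have "halts (Suc (length ys) * K) (Mark S ph' {} True, ys, [], R)
          (parse_weight (\<lambda>w. accepted ph' (\<lambda>i. counter i R + of_bool (i \<in> S) * w)) True ys)"
        proof (rule halts_Mark)
          fix R' w and zs :: "bool list"
          assume *: "0 \<notin> set R'" "length zs + length R' \<le> D" "length zs < length ys"
            "\<And>i. counter i R' =
              zip_counter i [] (counter i R + of_bool (i \<in> {}) + of_bool (i \<in> S) * w)"
          have "halts (Suc (length zs) * K) (Read ph' [], zs, [], R')
            (accepted ph' (\<lambda>i. counter i R') ([] @ zs))"
            using * Cons less.prems(3) code_nonempty by (intro less.hyps) auto
          then show "halts (Suc (length zs) * K) (Read ph' [], zs, [], R')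
            (accepted ph' (\<lambda>i. counter i R + of_bool (i \<in> S) * w) zs)"
            using * by simp
        qed (use less.prems Cons \<open>finite S\<close> in auto)
        then show ?thesis using accepted_code_iff[OF a] after Weight by simp
      next
        case (Finish ph')
        have "{(i, j). i < k \<and> j < k \<and> (counter i R < counter j R \<or>
            counter i R = counter j R \<and> (i, j) \<in> {..<k} \<times> {..<k})} =
          comparisons k (\<lambda>i. counter i R)"
          by (auto simp: comparisons_def)
        then have "halts (length R + 1) (entry a, ys, [], R)
            (accepted ph (\<lambda>i. counter i R) (?u @ ys))"
          using halts_Compare[of R "{..<k} \<times> {..<k}" ph' ys "[]"] less.prems Finish
            accepted_code_iff[OF a, of "\<lambda>i. counter i R" ys] by simp
        then show ?thesis using less.prems(2,3) after by (auto elim!: halts_mono)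
      qed
    next
      case no: False
      show ?thesis
      proof (cases "\<exists>z a. code ph (?u @ z) a")
        case True
        have "halts (Suc (length ys) * K) (Read ph ?u, ys, [], R)
          (accepted ph (\<lambda>i. counter i R) (?u @ ys))"
        proof (rule less.hyps)
          show "\<not> code ph u' a" if "?u = u' @ z" for u' z a
            using that no less.prems(4) by (cases z rule: rev_cases) auto
        qed (use less.prems Cons in auto)
        moreover have "after_read ph ?u = Read ph ?u" using no True by (auto simp: after_read_def)
        ultimately show ?thesis by simp
      next
        case False
        have "\<not> accepted ph (\<lambda>i. counter i R) (?u @ ys)"
        proof
          assume "accepted ph (\<lambda>i. counter i R) (?u @ ys)"
          then obtain v zs a where v: "?u @ ys = v @ zs" "code ph v a" by (rule accepted_imp_code)
          \<comment> \<open>A code word that begins the input either extends \<open>?u\<close> or is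
            a proper prefix of it; the first case is excluded by \<open>False\<close>, the second by
            the assumption on \<open>u\<close>.\<close>
          from v(1) consider z where "v = ?u @ z" | z where "z \<noteq> []" "?u = v @ z"
            by (metis append.right_neutral append_eq_append_conv2)
          then show False
          proof cases
            case 1
            then show ?thesis using False v by blast
          next
            case 2
            then show ?thesis using v less.prems(4) by (cases z rule: rev_cases) auto
          qed
        qed
        moreover have "after_read ph ?u = Rej" using no False by (auto simp: after_read_def)
        ultimately show ?thesis by (auto intro: halts_Rej)
      qed
    qed
    moreover have "step (Read ph u, xs, [], R) = (after_read ph ?u, ys, [], R)"
      using Cons less.prems(1) by simp
    ultimately have "halts (Suc (length ys) * K) (step (Read ph u, xs, [], R))
      (accepted ph (\<lambda>i. counter i R) (u @ xs))"
      using Cons by simp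
    then show ?thesis by (rule halts_step) (use Cons less.prems(3) in simp)
  qed
qed

end

section \<open>Simulation by a two-tape Turing machine\<close>

definition input_symbol :: "bool \<Rightarrow> nat" where
  "input_symbol b = (if b then 2 else 1)"

definition symbol_input :: "nat \<Rightarrow> bool option" where
  "symbol_input s = (if s = 1 then Some False else if s = 2 then Some True else None)"

lemma zipper_input_tape: "zipper_tape [] (map input_symbol x) (input_tape x)"
  by (auto simp: zipper_tape_def input_tape_def cell_def input_symbol_def)

lemma read_zipper_tape: "zipper_tape L R T \<Longrightarrow> read_tape T = cell R 0"
  by (cases T) (auto simp: zipper_tape_def dest: spec[of _ 0])

context weight_counting
begin

definition states :: "'p state set" where
  "states = {q. case q of
       Acc \<Rightarrow> True
     | Rej \<Rightarrow> True
     | Read ph u \<Rightarrow> ph \<in> P \<and> (u = [] \<or> (\<exists>z a. code ph (u @ z) a))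
     | Mark S ph c l \<Rightarrow> ph \<in> P \<and> S \<subseteq> {..<k} \<and> c \<subseteq> {..<k}
     | Bit S ph c \<Rightarrow> ph \<in> P \<and> S \<subseteq> {..<k} \<and> c \<subseteq> {..<k}
     | Carry ph c \<Rightarrow> ph \<in> P \<and> c \<subseteq> {..<k}
     | Rewind ph \<Rightarrow> ph \<in> P
     | Compare ph r \<Rightarrow> ph \<in> P \<and> r \<subseteq> {..<k} \<times> {..<k}}"

lemma finite_states: "finite states"
proof -
  let ?I = "Pow {..<k}"
  let ?U = "\<lambda>ph. insert [] (\<Union>u\<in>{u. \<exists>a. code ph u a}. (\<lambda>j. take j u) ` {..length u})"
  have U: "u \<in> ?U ph" if "u = [] \<or> (\<exists>z a. code ph (u @ z) a)" for ph u
    using that by (force intro: image_eqI[of _ _ "length u"])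
  let ?Q = "{Acc, Rej} \<union> (\<Union>ph\<in>P. Read ph ` ?U ph) \<union>
    (\<lambda>(S, ph, c, l). Mark S ph c l) ` (?I \<times> P \<times> ?I \<times> UNIV) \<union>
    (\<lambda>(S, ph, c). Bit S ph c) ` (?I \<times> P \<times> ?I) \<union>
    (\<lambda>(ph, c). Carry ph c) ` (P \<times> ?I) \<union> Rewind ` P \<union>
    (\<lambda>(ph, r). Compare ph r) ` (P \<times> Pow ({..<k} \<times> {..<k}))"
  have "states \<subseteq> ?Q"
  proof
    fix q assume q: "q \<in> states"
    show "q \<in> ?Q"
    proof (cases q)
      case (Read ph u)
      then have "ph \<in> P" "u = [] \<or> (\<exists>z a. code ph (u @ z) a)" using q by (simp_all add: states_def)
      moreover from U[OF this(2)] have "Read ph u \<in> Read ph ` ?U ph" by (rule imageI)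
      ultimately have "Read ph u \<in> (\<Union>ph\<in>P. Read ph ` ?U ph)" by (intro UN_I)
      then show ?thesis unfolding Read by (simp only: Un_iff simp_thms)
    next
      case (Mark S ph c l)
      then have "(S, ph, c, l) \<in> ?I \<times> P \<times> ?I \<times> UNIV" using q by (auto simp: states_def)
      then have "Mark S ph c l \<in> (\<lambda>(S, ph, c, l). Mark S ph c l) ` (?I \<times> P \<times> ?I \<times> UNIV)"
        by (rule rev_image_eqI) simp
      then show ?thesis unfolding Mark by (simp only: Un_iff simp_thms)
    next
      case (Bit S ph c)
      then have "(S, ph, c) \<in> ?I \<times> P \<times> ?I" using q by (auto simp: states_def)
      then have "Bit S ph c \<in> (\<lambda>(S, ph, c). Bit S ph c) ` (?I \<times> P \<times> ?I)"
        by (rule rev_image_eqI) simp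
      then show ?thesis unfolding Bit by (simp only: Un_iff simp_thms)
    next
      case (Carry ph c)
      then have "(ph, c) \<in> P \<times> ?I" using q by (auto simp: states_def)
      then have "Carry ph c \<in> (\<lambda>(ph, c). Carry ph c) ` (P \<times> ?I)"
        by (rule rev_image_eqI) simp
      then show ?thesis unfolding Carry by (simp only: Un_iff simp_thms)
    next
      case (Compare ph r)
      then have "(ph, r) \<in> P \<times> Pow ({..<k} \<times> {..<k})" using q by (auto simp: states_def)
      then have "Compare ph r \<in> (\<lambda>(ph, r). Compare ph r) ` (P \<times> Pow ({..<k} \<times> {..<k}))"
        by (rule rev_image_eqI) simp
      then show ?thesis unfolding Compare by (simp only: Un_iff simp_thms)
    next
      case (Rewind ph)
      then have "Rewind ph \<in> Rewind ` P" using q by (simp add: states_def)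
      then show ?thesis unfolding Rewind by (simp only: Un_iff simp_thms)
    qed simp_all
  qed
  moreover have "finite ?Q"
    using finite_P finite_code by (intro finite_UnI finite_imageI finite_cartesian_product) auto
  ultimately show ?thesis by (rule finite_subset)
qed

lemma after_read_states:
  assumes "ph \<in> P"
  shows "after_read ph u \<in> states"
proof (cases "\<exists>a. code ph u a")
  case True
  then obtain a where a: "code ph u a" by auto
  then have "(THE a. code ph u a) = a" using code_prefix_free by blast
  then show ?thesis using a code_P[OF assms a] code_Weight
    by (cases a) (auto simp: after_read_def states_def)
next
  case False
  then show ?thesis using assms by (auto simp: after_read_def states_def)
qed

lemma delta_closed:
  assumes "q \<in> states" "s < 2 ^ k + 1" "delta q b s = (q', adv, s', d)"
  shows "q' \<in> states \<and> s' < 2 ^ k + 1"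
proof -
  note dec = dec_subset[OF assms(2)]
  have sum: "sum_set (dec s) X Y \<subseteq> {..<k}" and carry: "carry_set (dec s) X Y \<subseteq> {..<k}"
    if "X \<subseteq> {..<k}" "Y \<subseteq> {..<k}" for X Y
    using that dec by (auto simp: sum_set_def carry_set_def)
  note enc = enc_less[OF sum]
  show ?thesis
    using assms after_read_states sum carry enc
    by (cases "(q, b, s)" rule: delta.cases)
      (auto simp: states_def compare_set_def split: if_splits)
qed

theorem polynomial_time_accepted: "polynomial_time_decidable {x. accepted start (\<lambda>_. 0) x}"
proof -
  obtain f where f: "bij_betw f states {0..<card states}"
    using ex_bij_betw_finite_nat[OF finite_states] by blast
  define g where "g = inv_into states f"
  have f_less: "f q < card states" if "q \<in> states" for q
    using f that by (auto simp: bij_betw_def)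
  have f_eq: "f q = f q' \<longleftrightarrow> q = q'" if "q \<in> states" "q' \<in> states" for q q'
    using f that by (auto simp: bij_betw_def inj_on_def)
  have g_f: "g (f q) = q" if "q \<in> states" for q
    using f that by (auto simp: g_def bij_betw_def)
  have g_states: "g n \<in> states" if "n < card states" for n
    using f that unfolding g_def by (intro inv_into_into) (auto simp: bij_betw_def)
  have final: "Acc \<in> states" "Rej \<in> states" "Read start [] \<in> states"
    using start_P by (auto simp: states_def)
  define M where "M = \<lparr>tm_tapes = 2, tm_symbols = 2 ^ k + 1, tm_states = card states,
    tm_start = f (Read start []), tm_accept = f Acc, tm_reject = f Rej,
    tm_trans = (\<lambda>n ss. case delta (g n) (symbol_input (ss ! 0)) (ss ! 1) of (q, adv, s, d) \<Rightarrow>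
      (f q, [(ss ! 0, if adv then Move_Right else Stay), (s, d)]))\<rparr>"
  have "wf_tm M"
  proof -
    have "(2::nat) ^ 1 \<le> 2 ^ k" using k_pos by (intro power_increasing) auto
    then have "3 \<le> tm_symbols M" by (simp add: M_def)
    moreover have "case tm_trans M n ss of (n', acts) \<Rightarrow>
        n' < tm_states M \<and> length acts = tm_tapes M \<and> (\<forall>(s, d)\<in>set acts. s < tm_symbols M)"
      if "n < tm_states M" "length ss = tm_tapes M" "set ss \<subseteq> {..<tm_symbols M}" for n ss
    proof -
      have ss: "ss ! 0 < 2 ^ k + 1" "ss ! 1 < 2 ^ k + 1"
        using that(2,3) by (auto simp: M_def subset_iff intro!: nth_mem)
      obtain q adv s d where *: "delta (g n) (symbol_input (ss ! 0)) (ss ! 1) = (q, adv, s, d)"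
        by (metis prod_cases4)
      have "g n \<in> states" using that(1) g_states by (simp add: M_def)
      from delta_closed[OF this ss(2) *] have "q \<in> states" "s < 2 ^ k + 1" by auto
      then show ?thesis using * ss f_less by (simp add: M_def)
    qed
    ultimately show ?thesis using final f_less f_eq by (auto simp: wf_tm_def M_def)
  qed
  \<comment> \<open>\<open>L0\<close> is existential because the input head never moves left. The
    bound on the work symbols is what \<open>delta_closed\<close> asks for.\<close>
  define rel where "rel = (\<lambda>(q, xs, L, R) (n, Ts).
    q \<in> states \<and> n = f q \<and> set L \<union> set R \<subseteq> {..<2 ^ k + 1} \<and>
    (\<exists>L0 T0 T1. Ts = [T0, T1] \<and> zipper_tape L0 (map input_symbol xs) T0 \<and> zipper_tape L R T1))"
  have rel_step: "rel (step c) (tm_step M e)" if "rel c e" for c e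
  proof -
    obtain q xs L R where c: "c = (q, xs, L, R)" by (metis prod_cases4)
    obtain L0 T0 T1 where e: "e = (f q, [T0, T1])" and T0: "zipper_tape L0 (map input_symbol xs) T0"
      and T1: "zipper_tape L R T1" and q: "q \<in> states" and LR: "set L \<union> set R \<subseteq> {..<2 ^ k + 1}"
      using \<open>rel c e\<close> by (cases e) (auto simp: rel_def c)
    show ?thesis
    proof (cases "q = Acc \<or> q = Rej")
      case True
      then show ?thesis using \<open>rel c e\<close> by (auto simp: c e M_def)
    next
      case False
      let ?b = "if xs = [] then None else Some (hd xs)"
      obtain q' adv s d where *: "delta q ?b (cell R 0) = (q', adv, s, d)"
        by (metis prod_cases4)
      obtain L' R' where move: "move_head d (L, cons_cell s (tl R)) = (L', R')" by fastforce
      have cell: "cell R 0 < 2 ^ k + 1" "cell L 0 < 2 ^ k + 1"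
        using LR by (auto simp: cell_def subset_iff)
      have q': "q' \<in> states" "s < 2 ^ k + 1" using delta_closed[OF q cell(1) *] by auto
      have "set (tl R) \<subseteq> set R" "set (tl L) \<subseteq> set L" by (cases R; auto) (cases L; auto)
      then have LR': "set L' \<union> set R' \<subseteq> {..<2 ^ k + 1}"
        using move LR q'(2) cell by (cases d) (auto simp: cons_cell_def split: if_splits)
      have b: "symbol_input (read_tape T0) = ?b"
        using read_zipper_tape[OF T0] by (cases xs) (auto simp: symbol_input_def input_symbol_def)
      have "cons_cell (read_tape T0) (tl (map input_symbol xs)) = map input_symbol xs"
        unfolding read_zipper_tape[OF T0]
        by (rule cons_cell_cell) (auto simp: input_symbol_def)
      then obtain L1 where T0': "zipper_tape L1 (map input_symbol (if adv then tl xs else xs))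
          (act_tape (read_tape T0, if adv then Move_Right else Stay) T0)"
        using zipper_tape_act[OF T0, of "if adv then Move_Right else Stay" "read_tape T0"]
        by (cases adv) (auto simp: map_tl)
      have "rel (q', if adv then tl xs else xs, L', R')
          (f q', [act_tape (read_tape T0, if adv then Move_Right else Stay) T0, act_tape (s, d) T1])"
        unfolding rel_def prod.case
        using q'(1) LR' T0' zipper_tape_act[OF T1 move] by blast
      moreover have "step c = (q', if adv then tl xs else xs, L', R')"
        using False * move by (simp add: c)
      moreover have "tm_step M e = (f q', [act_tape (read_tape T0, if adv then Move_Right else Stay) T0,
          act_tape (s, d) T1])"
        using False q * b f_eq final g_f[OF q] read_zipper_tape[OF T1] by (simp add: e M_def)
      ultimately show ?thesis by (simp only:)
    qed
  qed
  have rel_fst: "fst e = f (fst c)" if "rel c e" for c e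
    using that by (auto simp: rel_def)
  have rel_steps: "rel ((step ^^ t) c) ((tm_step M ^^ t) e)" if "rel c e" for c e t
    using that by (induction t) (auto intro: rel_step)
  \<comment> \<open>This is \<open>(n + 1) * (2 * n + 10)\<close>: the work tape starts empty, so
    \<open>D = n\<close> and \<open>K = 2 * n + 10\<close> are possible.\<close>
  define p where "p = [:10, 12, 2 :: nat:]"
  have "fst ((tm_step M ^^ poly p (length x)) (tm_initial M x)) =
      (if x \<in> {x. accepted start (\<lambda>_. 0) x} then tm_accept M else tm_reject M)" for x
  proof -
    have "zipper_tape [] [] (\<lambda>i. 0, 0)" by (simp add: zipper_tape_def)
    moreover have "tm_initial M x = (f (Read start []), [input_tape x, (\<lambda>i. 0, 0)])"
      by (simp add: tm_initial_def M_def)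
    ultimately have "rel (Read start [], x, [], []) (tm_initial M x)"
      unfolding rel_def prod.case using final zipper_input_tape by force
    from rel_steps[OF this]
    have "fst ((tm_step M ^^ t) (tm_initial M x)) = f (fst ((step ^^ t) (Read start [], x, [], [])))"
      for t
      by (rule rel_fst)
    moreover have "poly p (length x) = Suc (length x) * (2 * length x + 10)"
      by (simp add: p_def algebra_simps)
    moreover have "halts (Suc (length x) * (2 * length x + 10)) (Read start [], x, [], [])
        (accepted start (\<lambda>_. 0) x)"
      using halts_Read[of "[]" x "length x" "2 * length x + 10" "[]" start] code_nonempty by simp
    ultimately show ?thesis by (simp add: halts_def M_def)
  qed
  then show ?thesis
    using \<open>wf_tm M\<close> unfolding polynomial_time_decidable_def tm_decides_in_time_def by blast
qed

end

section \<open>Recognising manipulable instances\<close>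

datatype phase = Header | Votes nat nat | Manips nat nat

text \<open>The manipulators' vote is chosen only after all weights have been added, so for every
  \<open>R\<close> and \<open>c\<close> both possible scores are kept, with and without a
  veto.\<close>

definition index :: "nat set \<Rightarrow> nat \<Rightarrow> bool \<Rightarrow> nat" where
  "index R c b = prod_encode (set_encode R, prod_encode (c, of_bool b))"

lemma index_eq_iff:
  "finite R \<Longrightarrow> finite R' \<Longrightarrow> index R c b = index R' c' b' \<longleftrightarrow> R = R' \<and> c = c' \<and> b = b'"
  by (auto simp: index_def set_encode_eq)

text \<open>The indices have gaps, so the number is one more than the largest of them;
  \<open>insert 0\<close> covers \<open>m = 0\<close>, where there are none.\<close>

definition num_counters :: "nat \<Rightarrow> nat" where
  "num_counters m =
     Suc (Max (insert 0 ((\<lambda>(R, c, b). index R c b) ` (Pow {..<m} \<times> {..<m} \<times> UNIV))))"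

lemma index_less_num_counters:
  assumes "R \<subseteq> {..<m}" "c < m"
  shows "index R c b < num_counters m"
proof -
  have "index R c b \<in> (\<lambda>(R, c, b). index R c b) ` (Pow {..<m} \<times> {..<m} \<times> UNIV)"
    using assms by (intro image_eqI[of _ _ "(R, c, b)"]) auto
  then show ?thesis unfolding num_counters_def less_Suc_eq_le
    by (intro Max_ge) auto
qed

definition vote_counters :: "nat \<Rightarrow> nat vote \<Rightarrow> nat set" where
  "vote_counters n v = {index R c b | R c b. R \<subseteq> {..<n} \<and> c \<in> R \<and>
     vote_points (veto_vector (card R)) (restrict_vote R v) c = 1}"

definition manipulator_counters :: "nat \<Rightarrow> nat set" where
  "manipulator_counters n = {index R c True | R c. R \<subseteq> {..<n} \<and> c \<in> R}"

lemma index_in_counters_iff: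
  assumes "R \<subseteq> {..<n}" "c \<in> R"
  shows "index R c b \<in> vote_counters n v \<longleftrightarrow>
      vote_points (veto_vector (card R)) (restrict_vote R v) c = 1"
    and "index R c b \<in> manipulator_counters n \<longleftrightarrow> b"
proof -
  have eq: "index R c b = index R' c' b' \<longleftrightarrow> R = R' \<and> c = c' \<and> b = b'" if "R' \<subseteq> {..<n}" for R' c' b'
    using index_eq_iff finite_subset[OF assms(1)] finite_subset[OF that] by simp
  show "index R c b \<in> vote_counters n v \<longleftrightarrow>
      vote_points (veto_vector (card R)) (restrict_vote R v) c = 1" (is "_ \<longleftrightarrow> ?one")
  proof
    assume "index R c b \<in> vote_counters n v"
    then obtain R' c' b' where "index R c b = index R' c' b'" "R' \<subseteq> {..<n}"
      "vote_points (veto_vector (card R')) (restrict_vote R' v) c' = 1"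
      unfolding vote_counters_def mem_Collect_eq by (elim exE conjE)
    then show ?one by (simp add: eq)
  qed (use assms in \<open>unfold vote_counters_def, blast\<close>)
  show "index R c b \<in> manipulator_counters n \<longleftrightarrow> b"
  proof
    assume "index R c b \<in> manipulator_counters n"
    then obtain R' c' where "index R c b = index R' c' True" "R' \<subseteq> {..<n}"
      unfolding manipulator_counters_def mem_Collect_eq by (elim exE conjE)
    then show b by (simp add: eq)
  next
    assume b
    then have "index R c b = index R c True" by simp
    then show "index R c b \<in> manipulator_counters n"
      unfolding manipulator_counters_def mem_Collect_eq using assms by (intro exI conjI)
  qed
qed

text \<open>The leading \<open>True\<close> or \<open>False\<close> is the delimiter that
  \<open>encode_list\<close> writes before an entry or at the end of an outer list. Validity of the
  instance is checked here: a word with an invalid header or vote cannot be split into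
  blocks.\<close>

inductive code :: "nat \<Rightarrow> phase \<Rightarrow> bool list \<Rightarrow> phase action \<Rightarrow> bool" for m where
  header: "p < n \<Longrightarrow> n \<le> m \<Longrightarrow>
    code m Header (encode_nat n @ encode_nat p) (Goto (Votes n p))"
| vote: "n \<le> m \<Longrightarrow> top_truncated_vote {..<n} v \<Longrightarrow>
    code m (Votes n p) (True # encode_list encode_nat v) (Weight (vote_counters n v) (Votes n p))"
| votes_end: "code m (Votes n p) [False] (Goto (Manips n p))"
| manipulator: "n \<le> m \<Longrightarrow>
    code m (Manips n p) [True] (Weight (manipulator_counters n) (Manips n p))"
| manipulators_end: "code m (Manips n p) [False] (Finish (Manips n p))"

inductive_cases code_HeaderE: "code m Header u a"
inductive_cases code_VotesE: "code m (Votes n p) u a"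
inductive_cases code_ManipsE: "code m (Manips n p) u a"

definition phases :: "nat \<Rightarrow> phase set" where
  "phases m = insert Header (\<Union>n\<in>{..m}. \<Union>p\<in>{..<n}. {Votes n p, Manips n p})"

text \<open>Counter \<open>index R c b\<close> holds the score of \<open>c\<close> among the candidates
  \<open>R\<close> in the votes of the non-manipulators, increased by the total weight of the
  manipulators if \<open>b\<close> is true.\<close>

definition favourable :: "nat \<Rightarrow> nat \<Rightarrow> (nat \<Rightarrow> nat) \<Rightarrow> bool" where
  "favourable n p cnt \<longleftrightarrow> (\<exists>v. distinct v \<and> set v = {..<n} \<and>
     {c. survivor (\<lambda>R c. cnt (index R c (c \<noteq> last (restrict_vote R v)))) {..<n} c} = {p})"

text \<open>As a function of finitely many phases and relations this is a table in the control. It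
  refers to some counter values that induce \<open>r\<close>; \<open>verdict_comparisons\<close>
  shows that all such values agree.\<close>

definition verdict :: "nat \<Rightarrow> phase \<Rightarrow> (nat \<times> nat) set \<Rightarrow> bool" where
  "verdict m ph r \<longleftrightarrow> (case ph of
     Manips n p \<Rightarrow> \<exists>cnt. r = comparisons (num_counters m) cnt \<and> favourable n p cnt | _ \<Rightarrow> False)"

text \<open>A round compares only counters with the same \<open>R\<close>, and these lie below
  \<open>num_counters m\<close>, so \<open>survivor_cong\<close> applies.\<close>

lemma verdict_comparisons:
  assumes "n \<le> m"
  shows "verdict m (Manips n p) (comparisons (num_counters m) cnt) \<longleftrightarrow> favourable n p cnt"
proof
  assume "verdict m (Manips n p) (comparisons (num_counters m) cnt)"
  then obtain cnt' where eq: "comparisons (num_counters m) cnt = comparisons (num_counters m) cnt'"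
    and fav: "favourable n p cnt'"
    by (auto simp: verdict_def)
  have le: "cnt (index R c b) \<le> cnt (index R d b') \<longleftrightarrow> cnt' (index R c b) \<le> cnt' (index R d b')"
    if "R \<subseteq> {..<n}" "c \<in> R" "d \<in> R" for R c d b b'
  proof -
    have "index R c b < num_counters m" "index R d b' < num_counters m"
      using that assms by (auto intro!: index_less_num_counters)
    then show ?thesis using eq by (auto simp: comparisons_def set_eq_iff)
  qed
  have "survivor (\<lambda>R c. cnt (index R c (c \<noteq> last (restrict_vote R v)))) {..<n} =
      survivor (\<lambda>R c. cnt' (index R c (c \<noteq> last (restrict_vote R v)))) {..<n}" for v
    by (rule ext, rule survivor_cong) (rule le)
  then show "favourable n p cnt" using fav unfolding favourable_def by simp
qed (auto simp: verdict_def)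

interpretation cwcm: weight_counting "code m" "verdict m" "num_counters m" "phases m" Header for m
proof
  show "0 < num_counters m" by (simp add: num_counters_def)
  show "finite (phases m)" by (auto simp: phases_def)
  show "Header \<in> phases m" by (simp add: phases_def)
  show "finite {u. \<exists>a. code m ph u a}" if "ph \<in> phases m" for ph
  proof (cases ph)
    case Header
    have "{u. \<exists>a. code m ph u a} \<subseteq> (\<lambda>(n, p). encode_nat n @ encode_nat p) ` ({..m} \<times> {..m})"
      using Header by (force elim: code_HeaderE)
    then show ?thesis by (rule finite_subset) auto
  next
    case (Votes n p)
    let ?V = "{v. set v \<subseteq> {..<n} \<and> length v \<le> n}"
    have "v \<in> ?V" if "top_truncated_vote {..<n} v" for v
      using that card_mono[of "{..<n}" "set v"] by (simp add: top_truncated_vote_def distinct_card)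
    then have "{u. \<exists>a. code m ph u a} \<subseteq> insert [False] ((\<lambda>v. True # encode_list encode_nat v) ` ?V)"
      using Votes by (auto elim: code_VotesE)
    then show ?thesis by (rule finite_subset) (auto intro: finite_lists_length_le)
  next
    case (Manips n p)
    have "{u. \<exists>a. code m ph u a} \<subseteq> {[True], [False]}"
      using Manips by (auto elim: code_ManipsE)
    then show ?thesis by (rule finite_subset) auto
  qed
  show "set_action a \<subseteq> phases m" if "ph \<in> phases m" "code m ph u a" for ph u a
    using that(2,1) by cases (auto simp: phases_def)
  show "S \<subseteq> {..<num_counters m}" if "code m ph u (Weight S ph')" for ph u S ph'
    using that
  proof cases
    case (vote n v p)
    then show ?thesis by (force simp: vote_counters_def intro: index_less_num_counters)
  next
    case (manipulator n p)
    then show ?thesis by (force simp: manipulator_counters_def intro: index_less_num_counters)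
  qed
  show "\<not> code m ph [] a" for ph a
  proof
    assume "code m ph [] a"
    then show False
    proof cases
      case (header p n)
      then show ?thesis by (cases "n = 0") (auto simp: encode_nat_pos)
    qed
  qed
  show "u = u' \<and> a = a'" if "code m ph u a" "code m ph u' a'" "u @ x = u' @ y" for ph u a u' a' x y
    using that(1)
  proof cases
    case (header p n)
    from that(2) obtain p' n' where "u' = encode_nat n' @ encode_nat p'" "a' = Goto (Votes n' p')"
      unfolding header by (auto elim: code_HeaderE)
    then show ?thesis using header that(3) by (auto dest!: encode_nat_append_eq)
  next
    case (vote n v p)
    have "v = v'" if "encode_list encode_nat v @ x = encode_list encode_nat v' @ y" for v'
      using encode_list_append_eq[OF encode_nat_append_eq that] by simp
    then show ?thesis using vote that(2,3) by (auto elim!: code_VotesE)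
  next
    case (votes_end n p)
    then show ?thesis using that(2,3) by (auto elim!: code_VotesE)
  next
    case (manipulator n p)
    then show ?thesis using that(2,3) by (auto elim!: code_ManipsE)
  next
    case (manipulators_end n p)
    then show ?thesis using that(2,3) by (auto elim!: code_ManipsE)
  qed
qed

section \<open>Accepted words are the encodings of manipulable instances\<close>

lemma accepted_Manips_iff:
  assumes "n \<le> m"
  shows "cwcm.accepted m (Manips n p) cnt xs \<longleftrightarrow> (\<exists>ws. xs = encode_list encode_nat ws \<and>
    favourable n p (\<lambda>i. cnt i + of_bool (i \<in> manipulator_counters n) * sum_list ws))"
proof
  assume "cwcm.accepted m (Manips n p) cnt xs"
  then show "\<exists>ws. xs = encode_list encode_nat ws \<and>
    favourable n p (\<lambda>i. cnt i + of_bool (i \<in> manipulator_counters n) * sum_list ws)"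
  proof (induction "Manips n p" cnt xs rule: cwcm.accepted.induct)
    case (goto u ph' cnt xs)
    from goto(1) show ?case by (auto elim: code_ManipsE)
  next
    case (weight u S ph' cnt w xs)
    from weight(1) have u: "u = [True]" "S = manipulator_counters n" "ph' = Manips n p"
      by (auto elim: code_ManipsE)
    from weight(3)[OF u(3)] obtain ws where ws: "xs = encode_list encode_nat ws"
      "favourable n p (\<lambda>i. cnt i + of_bool (i \<in> S) * w +
         of_bool (i \<in> manipulator_counters n) * sum_list ws)"
      by blast
    then show ?case unfolding u
      by (intro exI[of _ "w # ws"]) (simp add: distrib_left add.assoc)
  next
    case (finish u ph' cnt)
    from finish(1) have u: "u = [False]" "ph' = Manips n p" by (auto elim: code_ManipsE)
    then show ?case using finish(2) verdict_comparisons[OF assms]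
      by (intro exI[of _ "[]"]) simp
  qed
next
  assume "\<exists>ws. xs = encode_list encode_nat ws \<and>
    favourable n p (\<lambda>i. cnt i + of_bool (i \<in> manipulator_counters n) * sum_list ws)"
  then obtain ws where xs: "xs = encode_list encode_nat ws" and
    "favourable n p (\<lambda>i. cnt i + of_bool (i \<in> manipulator_counters n) * sum_list ws)" by blast
  from this(2) have "cwcm.accepted m (Manips n p) cnt (encode_list encode_nat ws)"
  proof (induction ws arbitrary: cnt)
    case Nil
    then show ?case using cwcm.accepted.finish[OF code.manipulators_end] verdict_comparisons[OF assms]
      by simp
  next
    case (Cons w ws)
    have "cwcm.accepted m (Manips n p) (\<lambda>i. cnt i + of_bool (i \<in> manipulator_counters n) * w)
        (encode_list encode_nat ws)"
      using Cons.prems by (intro Cons.IH) (simp add: distrib_left add.assoc)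
    from cwcm.accepted.weight[OF code.manipulator[OF assms] this] show ?case by simp
  qed
  then show "cwcm.accepted m (Manips n p) cnt xs" unfolding xs .
qed

definition total_counts :: "nat \<Rightarrow> (nat vote \<times> nat) list \<Rightarrow> nat list \<Rightarrow> nat \<Rightarrow> nat" where
  "total_counts n V ws i = (\<Sum>(v, w)\<leftarrow>V. of_bool (i \<in> vote_counters n v) * w) +
     of_bool (i \<in> manipulator_counters n) * sum_list ws"

lemma accepted_Votes_iff:
  assumes "n \<le> m"
  shows "cwcm.accepted m (Votes n p) cnt xs \<longleftrightarrow> (\<exists>V ws.
    xs = encode_list (\<lambda>(v, w). encode_list encode_nat v @ encode_nat w) V @ encode_list encode_nat ws \<and>
    (\<forall>(v, w)\<in>set V. top_truncated_vote {..<n} v) \<and>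
    favourable n p (\<lambda>i. cnt i + total_counts n V ws i))"
    (is "_ \<longleftrightarrow> (\<exists>V ws. xs = ?enc V @ _ \<and> ?valid V \<and> _)")
proof
  assume "cwcm.accepted m (Votes n p) cnt xs"
  then show "\<exists>V ws. xs = ?enc V @ encode_list encode_nat ws \<and> ?valid V \<and>
    favourable n p (\<lambda>i. cnt i + total_counts n V ws i)"
  proof (induction "Votes n p" cnt xs rule: cwcm.accepted.induct)
    case (goto u ph' cnt xs)
    from goto(1) have u: "u = [False]" "ph' = Manips n p" by (auto elim: code_VotesE)
    from goto(2) obtain ws where "xs = encode_list encode_nat ws"
      "favourable n p (\<lambda>i. cnt i + of_bool (i \<in> manipulator_counters n) * sum_list ws)"
      unfolding u accepted_Manips_iff[OF assms] by blast
    then show ?case unfolding u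
      by (intro exI[of _ "[]"] exI[of _ ws]) (simp add: total_counts_def)
  next
    case (weight u S ph' cnt w xs)
    from weight(1) obtain v where u: "u = True # encode_list encode_nat v" "S = vote_counters n v"
      "ph' = Votes n p" "top_truncated_vote {..<n} v"
      by (auto elim: code_VotesE)
    from weight(3)[OF u(3)] obtain V ws where ws: "xs = ?enc V @ encode_list encode_nat ws" "?valid V"
      "favourable n p (\<lambda>i. cnt i + of_bool (i \<in> S) * w + total_counts n V ws i)"
      by blast
    then show ?case using u(4) unfolding u(1,2)
      by (intro exI[of _ "(v, w) # V"] exI[of _ ws]) (simp add: total_counts_def add.assoc)
  next
    case (finish u ph' cnt)
    from finish(1) show ?case by (auto elim: code_VotesE)
  qed
next
  assume "\<exists>V ws. xs = ?enc V @ encode_list encode_nat ws \<and> ?valid V \<and>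
    favourable n p (\<lambda>i. cnt i + total_counts n V ws i)"
  then obtain V ws where xs: "xs = ?enc V @ encode_list encode_nat ws" and
    "?valid V" "favourable n p (\<lambda>i. cnt i + total_counts n V ws i)" by blast
  from this(2,3) have "cwcm.accepted m (Votes n p) cnt (?enc V @ encode_list encode_nat ws)"
  proof (induction V arbitrary: cnt)
    case Nil
    then have "cwcm.accepted m (Manips n p) cnt (encode_list encode_nat ws)"
      unfolding accepted_Manips_iff[OF assms] by (auto simp: total_counts_def)
    from cwcm.accepted.goto[OF code.votes_end this] show ?case by simp
  next
    case (Cons x V)
    obtain v w where x: "x = (v, w)" by (cases x)
    have "cwcm.accepted m (Votes n p) (\<lambda>i. cnt i + of_bool (i \<in> vote_counters n v) * w)
        (?enc V @ encode_list encode_nat ws)"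
      using Cons.prems by (intro Cons.IH) (simp_all add: x total_counts_def add.assoc)
    moreover have "top_truncated_vote {..<n} v" using Cons.prems x by simp
    ultimately show ?case
      using cwcm.accepted.weight[OF code.vote[OF assms], of v p cnt w] by (simp add: x)
  qed
  then show "cwcm.accepted m (Votes n p) cnt xs" unfolding xs .
qed

lemma accepted_Header_iff:
  "cwcm.accepted m Header cnt xs \<longleftrightarrow> (\<exists>n p ys. p < n \<and> n \<le> m \<and>
    xs = encode_nat n @ encode_nat p @ ys \<and> cwcm.accepted m (Votes n p) cnt ys)"
proof
  assume "cwcm.accepted m Header cnt xs"
  then show "\<exists>n p ys. p < n \<and> n \<le> m \<and>
    xs = encode_nat n @ encode_nat p @ ys \<and> cwcm.accepted m (Votes n p) cnt ys"
    by (cases rule: cwcm.accepted.cases) (auto elim!: code_HeaderE, blast)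
next
  assume "\<exists>n p ys. p < n \<and> n \<le> m \<and>
    xs = encode_nat n @ encode_nat p @ ys \<and> cwcm.accepted m (Votes n p) cnt ys"
  then show "cwcm.accepted m Header cnt xs"
    using cwcm.accepted.goto[OF code.header] by fastforce
qed

text \<open>Veto points are 0 or 1, so membership in \<open>vote_counters\<close> carries the same
  information as the points, and adding weights under this test yields the score.\<close>

lemma total_counts_index:
  assumes "\<forall>(v, w)\<in>set V. top_truncated_vote {..<n} v" "R \<subseteq> {..<n}" "c \<in> R"
  shows "total_counts n V ws (index R c b) = veto_score V R c + of_bool b * sum_list ws"
proof -
  have "of_bool (index R c b \<in> vote_counters n v) =
      vote_points (veto_vector (card R)) (restrict_vote R v) c" if "top_truncated_vote {..<n} v" for v
  proof -
    have "vote_points (veto_vector (card R)) (restrict_vote R v) c \<le> 1"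
      using that finite_subset[OF assms(2)]
      by (intro vote_points_veto) (auto simp: top_truncated_vote_def restrict_vote_def)
    then show ?thesis unfolding index_in_counters_iff(1)[OF assms(2,3)] by auto
  qed
  then have "(\<Sum>(v, w)\<leftarrow>V. of_bool (index R c b \<in> vote_counters n v) * w) = veto_score V R c"
    using assms(1) unfolding veto_score_eq by (induction V) (auto simp: mult.commute)
  then show ?thesis unfolding total_counts_def index_in_counters_iff(2)[OF assms(2,3)] by simp
qed

lemma manipulable_iff_favourable:
  assumes "valid_instance I"
  shows "manipulable I \<longleftrightarrow> favourable (ncand I) (preferred I)
    (total_counts (ncand I) (nonmanipulators I) (manipulator_weights I))"
proof -
  let ?cnt = "total_counts (ncand I) (nonmanipulators I) (manipulator_weights I)"
  let ?rev = "reverse_score (veto_score (nonmanipulators I)) (sum_list (manipulator_weights I))"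
  have "\<forall>(v, w)\<in>set (nonmanipulators I). top_truncated_vote {..<ncand I} v"
    using assms by (simp add: valid_instance_def)
  note index = total_counts_index[OF this]
  have "survivor (\<lambda>R c. ?cnt (index R c (c \<noteq> last (restrict_vote R v)))) {..<ncand I} =
      survivor (?rev v) {..<ncand I}" for v
  proof (rule ext, rule survivor_cong)
    fix R d e
    assume R: "R \<subseteq> {..<ncand I}" "d \<in> R" "e \<in> R"
    show "?cnt (index R d (d \<noteq> last (restrict_vote R v))) \<le> ?cnt (index R e (e \<noteq> last (restrict_vote R v)))
      \<longleftrightarrow> ?rev v R d \<le> ?rev v R e"
      unfolding index[OF R(1,2)] index[OF R(1,3)] reverse_score_def by simp
  qed
  then show ?thesis unfolding manipulable_iff[OF assms] favourable_def by simp
qed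

lemma CWCM_eliminate_veto_eq: "CWCM_eliminate_veto m = {x. cwcm.accepted m Header (\<lambda>_. 0) x}"
proof (intro set_eqI iffI)
  fix x assume "x \<in> CWCM_eliminate_veto m"
  then obtain I where I: "x = encode_instance I" "valid_instance I" "ncand I \<le> m" "manipulable I"
    by (auto simp: CWCM_eliminate_veto_def)
  have "cwcm.accepted m (Votes (ncand I) (preferred I)) (\<lambda>_. 0)
    (encode_list (\<lambda>(v, w). encode_list encode_nat v @ encode_nat w) (nonmanipulators I) @
     encode_list encode_nat (manipulator_weights I))"
    unfolding accepted_Votes_iff[OF I(3)]
    using I(2,4) manipulable_iff_favourable[OF I(2)]
    by (intro exI[of _ "nonmanipulators I"] exI[of _ "manipulator_weights I"])
      (simp add: valid_instance_def)
  then show "x \<in> {x. cwcm.accepted m Header (\<lambda>_. 0) x}"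
    using I(1-3) unfolding mem_Collect_eq accepted_Header_iff encode_instance_def valid_instance_def
    by blast
next
  fix x assume "x \<in> {x. cwcm.accepted m Header (\<lambda>_. 0) x}"
  then obtain n p V ws where np: "p < n" "n \<le> m" and x: "x = encode_nat n @ encode_nat p @
      encode_list (\<lambda>(v, w). encode_list encode_nat v @ encode_nat w) V @ encode_list encode_nat ws"
    and V: "\<forall>(v, w)\<in>set V. top_truncated_vote {..<n} v"
    and fav: "favourable n p (\<lambda>i. 0 + total_counts n V ws i)"
    unfolding mem_Collect_eq accepted_Header_iff by (auto simp: accepted_Votes_iff)
  let ?I = "\<lparr>ncand = n, preferred = p, nonmanipulators = V, manipulator_weights = ws\<rparr>"
  have I: "valid_instance ?I" using np V by (simp add: valid_instance_def)
  have "manipulable ?I" using manipulable_iff_favourable[OF I] fav by simp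
  moreover have "x = encode_instance ?I" by (simp add: x encode_instance_def)
  ultimately show "x \<in> CWCM_eliminate_veto m"
    using I np unfolding CWCM_eliminate_veto_def by fastforce
qed

theorem corollary1:
  fixes m :: nat
  shows "polynomial_time_decidable (CWCM_eliminate_veto m)"
  unfolding CWCM_eliminate_veto_eq by (rule cwcm.polynomial_time_accepted)

end
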